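(* Let $n\ge 1$. If $Z\colon \mathrm{Conv}_{\rm sc}(\mathbb{R}^n)\to\mathbb{R}$ is a continuous and epi-translation invariant valuation, then there are continuous and epi-translation invariant valuations $Z_0,\dots,Z_n\colon \mathrm{Conv}_{\rm sc}(\mathbb{R}^n)\to\mathbb{R}$ such that $Z_i$ is epi-homogeneous of degree $i$ for each $i\in\{0,\dots,n\}$ and $Z=Z_0+\dots+Z_n$.
   Context: $\mathrm{Conv}(\mathbb{R}^n)$ is the set of convex, lower semicontinuous functions $u\colon\mathbb{R}^n\to\mathbb{R}\cup\{+\infty\}$ with $u\not\equiv+\infty$. $\mathrm{Conv}_{\rm sc}(\mathbb{R}^n)$ is the subset of super-coercive functions, i.e. those $u\in\mathrm{Conv}(\mathbb{R}^n)$ with $\lim_{|x|\to+\infty}u(x)/|x|=+\infty$. Topology: continuity is with respect to epi-convergence. A sequence $u_k$ epi-converges to $u$ if for every $x\in\mathbb{R}^n$: (i) $u(x)\le\liminf_{k\to\infty}u_k(x_k)$ for every sequence $x_k\to x$, and (ii) there is a sequence $x_k\to x$ with $u(x)=\lim_{k\to\infty}u_k(x_k)$. A functional $Z\colon X\to\mathbb{R}$ on a set $X$ of functions is a valuation if $Z(u\vee v)+Z(u\wedge v)=Z(u)+Z(v)$ for all $u,v\in X$ with $u\vee v\in X$ and $u\wedge v\in X$, where $\vee$ and $\wedge$ denote pointwise maximum and minimum. $Z$ is epi-translation invariant if it is translation invariant ($Z(u\circ\tau^{-1})=Z(u)$ for all $u$ and all translations $\tau\colon\mathbb{R}^n\to\mathbb{R}^n$)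 and vertically translation invariant ($Z(u+\alpha)=Z(u)$ for all $u$ and all constants $\alpha\in\mathbb{R}$). For $\lambda>0$, epi-multiplication is $(\lambda\cdot_{\rm epi} u)(x)=\lambda\,u(x/\lambda)$. $Z$ is epi-homogeneous of degree $\alpha\in\mathbb{R}$ if $Z(\lambda\cdot_{\rm epi}u)=\lambda^\alpha Z(u)$ for all $u$ and all $\lambda>0$. *)

theory Defs
  imports "HOL-Analysis.Analysis"
begin

(* Functions into R \<union> {+\<infinity>} are ereal-valued functions avoiding -\<infinity>.  The convention
   0 * \<infinity> = 0 of ereal makes the convexity inequality trivial at t = 0 and t = 1. *)

definition Conv :: "(real ^ 'n \<Rightarrow> ereal) set" where
  "Conv = {u. (\<forall>x. u x \<noteq> -\<infinity>)
            \<and> (\<exists>x. u x \<noteq> \<infinity>)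
            \<and> (\<forall>x y. \<forall>t\<in>{0..1}.
                 u ((1 - t) *\<^sub>R x + t *\<^sub>R y) \<le> ereal (1 - t) * u x + ereal t * u y)
            \<and> (\<forall>x. u x \<le> Liminf (at x) u)}"

definition Conv_sc :: "(real ^ 'n \<Rightarrow> ereal) set" where
  "Conv_sc = {u \<in> Conv. ((\<lambda>x. u x / ereal (norm x)) \<longlongrightarrow> \<infinity>) at_infinity}"

definition epi_converges ::
    "(nat \<Rightarrow> real ^ 'n \<Rightarrow> ereal) \<Rightarrow> (real ^ 'n \<Rightarrow> ereal) \<Rightarrow> bool" where
  "epi_converges U u \<longleftrightarrow>
     (\<forall>x. (\<forall>X. X \<longlonglongrightarrow> x \<longrightarrow> u x \<le> liminf (\<lambda>k. U k (X k)))
        \<and> (\<exists>X. X \<longlonglongrightarrow> x \<and> (\<lambda>k. U k (X k)) \<longlonglongrightarrow> u x))"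

(* In the predicates below Z is a functional on F; its values outside F are irrelevant. *)

definition epi_continuous ::
    "(real ^ 'n \<Rightarrow> ereal) set \<Rightarrow> ((real ^ 'n \<Rightarrow> ereal) \<Rightarrow> real) \<Rightarrow> bool" where
  "epi_continuous F Z \<longleftrightarrow>
     (\<forall>U. \<forall>u\<in>F. (\<forall>k. U k \<in> F) \<longrightarrow> epi_converges U u \<longrightarrow> (\<lambda>k. Z (U k)) \<longlonglongrightarrow> Z u)"

definition valuation ::
    "(real ^ 'n \<Rightarrow> ereal) set \<Rightarrow> ((real ^ 'n \<Rightarrow> ereal) \<Rightarrow> real) \<Rightarrow> bool" where
  "valuation F Z \<longleftrightarrow>
     (\<forall>u\<in>F. \<forall>v\<in>F. (\<lambda>x. max (u x) (v x)) \<in> F \<longrightarrow> (\<lambda>x. min (u x) (v x)) \<in> F \<longrightarrow>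
        Z (\<lambda>x. max (u x) (v x)) + Z (\<lambda>x. min (u x) (v x)) = Z u + Z v)"

definition translation_invariant ::
    "(real ^ 'n \<Rightarrow> ereal) set \<Rightarrow> ((real ^ 'n \<Rightarrow> ereal) \<Rightarrow> real) \<Rightarrow> bool" where
  "translation_invariant F Z \<longleftrightarrow> (\<forall>u\<in>F. \<forall>a. Z (\<lambda>x. u (x - a)) = Z u)"

definition vertically_translation_invariant ::
    "(real ^ 'n \<Rightarrow> ereal) set \<Rightarrow> ((real ^ 'n \<Rightarrow> ereal) \<Rightarrow> real) \<Rightarrow> bool" where
  "vertically_translation_invariant F Z \<longleftrightarrow> (\<forall>u\<in>F. \<forall>c::real. Z (\<lambda>x. u x + ereal c) = Z u)"

definition epi_translation_invariant ::
    "(real ^ 'n \<Rightarrow> ereal) set \<Rightarrow> ((real ^ 'n \<Rightarrow> ereal) \<Rightarrow> real) \<Rightarrow> bool" where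
  "epi_translation_invariant F Z \<longleftrightarrow>
     translation_invariant F Z \<and> vertically_translation_invariant F Z"

definition epi_mult :: "real \<Rightarrow> (real ^ 'n \<Rightarrow> ereal) \<Rightarrow> (real ^ 'n \<Rightarrow> ereal)" where
  "epi_mult l u = (\<lambda>x. ereal l * u (x /\<^sub>R l))"

definition epi_homogeneous ::
    "(real ^ 'n \<Rightarrow> ereal) set \<Rightarrow> real \<Rightarrow> ((real ^ 'n \<Rightarrow> ereal) \<Rightarrow> real) \<Rightarrow> bool" where
  "epi_homogeneous F a Z \<longleftrightarrow> (\<forall>u\<in>F. \<forall>l>0. Z (epi_mult l u) = l powr a * Z u)"

end

theory Submission
  imports Defs "HOL-Computational_Algebra.Polynomial"
begin

text \<open>Composing \<open>Z\<close> with Legendre conjugation gives a valuation \<open>F\<close> on finite convex functions which is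
  invariant under adding affine functions, and epi-multiplication becomes ordinary scaling. If
  \<open>v\<close> is a maximum of \<open>N\<close> affine functions, then \<open>F (k v)\<close> is a polynomial in \<open>k\<close> of degree less than
  \<open>N\<close>: with \<open>T\<^sub>f F = F (f + \<cdot>)\<close>, the valuation property applied to \<open>v + a\<close> and \<open>v + b\<close>, where
  \<open>v = max a b\<close>, says \<open>(T\<^sub>v - T\<^sub>a) (T\<^sub>v - T\<^sub>b) F = 0\<close>, and induction on \<open>N\<close> gives \<open>(T\<^sub>v - 1)\<^sup>N F = 0\<close>.
  Among \<open>n + 2\<close> affine functions on \<open>\<real>\<^sup>n\<close> there is a Radon relation, which allows \<open>F (k v)\<close>
  to be written as a combination of such values with at most \<open>n + 1\<close> affine functions, so the degree is
  at most \<open>n\<close>. Conjugates of maxima of affine functions being dense, continuity shows that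
  \<open>Z\<close> is polynomial of degree at most \<open>n\<close> under epi-multiplication, and the coefficients, obtained
  by Lagrange interpolation, are the homogeneous components.\<close>

section \<open>Polynomials\<close>

text \<open>Polynomial functions of degree at most \<open>d\<close> on the naturals, in the basis in
  which summing differences only shifts the coefficients.\<close>

definition binomial_sum :: "nat \<Rightarrow> (nat \<Rightarrow> real) \<Rightarrow> bool" where
  "binomial_sum d f \<longleftrightarrow> (\<exists>c. \<forall>k. f k = (\<Sum>j\<le>d. c j * real (k choose j)))"

lemma binomial_sumI: "(\<And>k. f k = (\<Sum>j\<le>d. c j * real (k choose j))) \<Longrightarrow> binomial_sum d f"
  unfolding binomial_sum_def by auto

lemma binomial_sum_mono:
  assumes "binomial_sum d f" "d \<le> e"
  shows "binomial_sum e f"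
proof -
  obtain c where c: "\<And>k. f k = (\<Sum>j\<le>d. c j * real (k choose j))"
    using assms(1) unfolding binomial_sum_def by auto
  have "f k = (\<Sum>j\<le>e. (if j \<le> d then c j else 0) * real (k choose j))" for k
    unfolding c by (rule sum.mono_neutral_cong_left) (use assms(2) in auto)
  then show ?thesis by (rule binomial_sumI)
qed

lemma binomial_sum_add:
  assumes "binomial_sum d f" "binomial_sum d g"
  shows "binomial_sum d (\<lambda>k. f k + g k)"
proof -
  obtain a b where "\<And>k. f k = (\<Sum>j\<le>d. a j * real (k choose j))"
    "\<And>k. g k = (\<Sum>j\<le>d. b j * real (k choose j))"
    using assms unfolding binomial_sum_def by auto
  then have "f k + g k = (\<Sum>j\<le>d. (a j + b j) * real (k choose j))" for k
    by (simp add: sum.distrib algebra_simps)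
  then show ?thesis by (rule binomial_sumI)
qed

lemma binomial_sum_uminus:
  assumes "binomial_sum d f"
  shows "binomial_sum d (\<lambda>k. - f k)"
proof -
  obtain a where "\<And>k. f k = (\<Sum>j\<le>d. a j * real (k choose j))"
    using assms unfolding binomial_sum_def by auto
  then have "- f k = (\<Sum>j\<le>d. (- a j) * real (k choose j))" for k
    by (simp add: sum_negf)
  then show ?thesis by (rule binomial_sumI)
qed

text \<open>By Pascal's rule \<open>k choose Suc j\<close> is the discrete antiderivative of
  \<open>k choose j\<close>; the constant of summation is \<open>f 0\<close>.\<close>

lemma binomial_sum_of_difference:
  assumes "binomial_sum d (\<lambda>k. f (Suc k) - f k)"
  shows "binomial_sum (Suc d) f"
proof -
  obtain c where c: "\<And>k. f (Suc k) - f k = (\<Sum>j\<le>d. c j * real (k choose j))"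
    using assms unfolding binomial_sum_def by auto
  define a where "a j = (case j of 0 \<Rightarrow> f 0 | Suc i \<Rightarrow> c i)" for j
  have split: "(\<Sum>j\<le>Suc d. a j * real (k choose j)) = f 0 + (\<Sum>j\<le>d. c j * real (k choose Suc j))" for k
    unfolding sum.atMost_Suc_shift by (simp add: a_def)
  have "f k = f 0 + (\<Sum>j\<le>d. c j * real (k choose Suc j))" for k
  proof (induction k)
    case (Suc k)
    have "(\<Sum>j\<le>d. c j * real (Suc k choose Suc j)) =
        (\<Sum>j\<le>d. c j * real (k choose j)) + (\<Sum>j\<le>d. c j * real (k choose Suc j))"
      by (simp add: distrib_left flip: sum.distrib)
    then show ?case using c[of k] Suc by linarith
  qed simp
  then have "f k = (\<Sum>j\<le>Suc d. a j * real (k choose j))" for k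
    by (rule trans[OF _ split[symmetric]])
  then show ?thesis by (rule binomial_sumI)
qed

text \<open>\<open>k choose j\<close> is the product of the factors \<open>k - i\<close> with
  \<open>i < j\<close>, divided by \<open>fact j\<close>.\<close>

lemma binomial_sum_imp_poly:
  assumes "binomial_sum d f"
  obtains p :: "real poly" where "degree p \<le> d" "\<And>k. f k = poly p (real k)"
proof -
  obtain c where c: "\<And>k. f k = (\<Sum>j\<le>d. c j * real (k choose j))"
    using assms unfolding binomial_sum_def by auto
  define b :: "nat \<Rightarrow> real poly" where "b j = (\<Prod>i<j. [:- real i, 1:])" for j
  have "degree (b j) = j" for j
    by (simp add: b_def degree_prod_eq_sum_degree)
  then have deg: "degree (\<Sum>j\<le>d. smult (c j / fact j) (b j)) \<le> d"
    by (intro degree_sum_le) (auto intro: order.trans[OF degree_smult_le])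
  have "real (k choose j) = poly (b j) (real k) / fact j" for k j
    by (simp add: b_def poly_prod binomial_gbinomial gbinomial_prod_rev atLeast0LessThan)
  then have "f k = poly (\<Sum>j\<le>d. smult (c j / fact j) (b j)) (real k)" for k
    by (simp add: c poly_sum)
  then show ?thesis using deg that by blast
qed

text \<open>The nodes are \<open>1, \<dots>, n + 1\<close>: epi-multiplication is only available for positive factors.\<close>

definition lagrange :: "nat \<Rightarrow> nat \<Rightarrow> real poly" where
  "lagrange n j = smult (1 / (\<Prod>m\<in>{1..Suc n} - {j}. real j - real m))
     (\<Prod>m\<in>{1..Suc n} - {j}. [:- real m, 1:])"

lemma degree_lagrange:
  assumes "j \<in> {1..Suc n}"
  shows "degree (lagrange n j) \<le> n"
proof -
  have "degree (\<Prod>m\<in>{1..Suc n} - {j}. [:- real m, 1:]) = card ({1..Suc n} - {j})"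
    by (subst degree_prod_eq_sum_degree) auto
  also have "\<dots> = n"
    by (subst card_Diff_singleton[OF assms]) simp
  finally show ?thesis
    unfolding lagrange_def by (intro order.trans[OF degree_smult_le]) (rule eq_refl)
qed

lemma poly_lagrange:
  assumes "j \<in> {1..Suc n}" "i \<in> {1..Suc n}"
  shows "poly (lagrange n j) (real i) = (if i = j then 1 else 0)"
proof (cases "i = j")
  case True
  have "(\<Prod>m\<in>{1..Suc n} - {j}. real j - real m) \<noteq> 0"
    by (subst prod_zero_iff) auto
  then show ?thesis
    using True unfolding lagrange_def poly_smult poly_prod by (simp del: prod_zero_iff)
next
  case False
  have "(\<Prod>m\<in>{1..Suc n} - {j}. poly [:- real m, 1:] (real i)) = 0"
    by (rule prod_zero) (use False assms(2) in \<open>auto intro!: bexI[of _ i]\<close>)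
  then show ?thesis
    using False unfolding lagrange_def poly_smult poly_prod by simp
qed

text \<open>Both sides have degree at most \<open>n\<close> and agree at the \<open>n + 1\<close>
  nodes.\<close>

lemma lagrange_interpolation:
  assumes "degree p \<le> n"
  shows "p = (\<Sum>j = 1..Suc n. smult (poly p (real j)) (lagrange n j))" (is "_ = ?q")
proof (rule poly_eqI_degree)
  show "poly p x = poly ?q x" if x: "x \<in> real ` {1..Suc n}" for x
  proof -
    obtain i where i: "i \<in> {1..Suc n}" "x = real i" using x by blast
    have "poly ?q x = (\<Sum>j = 1..Suc n. if j = i then poly p (real i) else 0)"
      unfolding poly_sum by (rule sum.cong) (use i poly_lagrange[OF _ i(1)] in auto)
    then show ?thesis using i by simp
  qed
  have "degree ?q \<le> n"
    by (intro degree_sum_le) (auto intro: order.trans[OF degree_smult_le] degree_lagrange)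
  moreover have "card (real ` {1..Suc n}) = Suc n" by (simp add: card_image)
  ultimately show "degree p < card (real ` {1..Suc n})" "degree ?q < card (real ` {1..Suc n})"
    using assms by linarith+
qed

section \<open>Valuations on finite convex functions\<close>

text \<open>Every finite convex function has an affine minorant; requiring it here makes it immediate that the
  conjugate is not identically \<open>\<infinity>\<close>.\<close>

definition dual_fun :: "('a::euclidean_space \<Rightarrow> real) \<Rightarrow> bool" where
  "dual_fun v \<longleftrightarrow> convex_on UNIV v \<and> (\<exists>a b. \<forall>x. a \<bullet> x + b \<le> v x)"

lemma dual_fun_add:
  assumes "dual_fun v" "dual_fun w"
  shows "dual_fun (\<lambda>x. v x + w x)"
proof -
  obtain a b c d where *: "\<And>x. a \<bullet> x + b \<le> v x" "\<And>x. c \<bullet> x + d \<le> w x"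
    using assms unfolding dual_fun_def by auto
  have "(a + c) \<bullet> x + (b + d) \<le> v x + w x" for x
    using *[of x] by (simp add: inner_add_left)
  then show ?thesis using assms convex_on_add unfolding dual_fun_def by blast
qed

lemma dual_fun_max:
  assumes "dual_fun v" "dual_fun w"
  shows "dual_fun (\<lambda>x. max (v x) (w x))"
proof -
  obtain a b where ab: "\<And>x. a \<bullet> x + b \<le> v x"
    using assms unfolding dual_fun_def by auto
  have "a \<bullet> x + b \<le> max (v x) (w x)" for x
    using ab[of x] by simp
  moreover have "convex_on UNIV (\<lambda>x. max (v x) (w x))"
    using assms unfolding dual_fun_def convex_on_def
    by (smt (verit) max.cobounded1 max.cobounded2 max_def mult_left_mono)
  ultimately show ?thesis unfolding dual_fun_def by blast
qed

lemma dual_fun_scale: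
  assumes "dual_fun v" "0 \<le> r"
  shows "dual_fun (\<lambda>x. r * v x)"
proof -
  obtain a b where ab: "\<And>x. a \<bullet> x + b \<le> v x"
    using assms unfolding dual_fun_def by auto
  have "(r *\<^sub>R a) \<bullet> x + r * b \<le> r * v x" for x
    using mult_left_mono[OF ab[of x] assms(2)] by (simp add: algebra_simps)
  then show ?thesis using assms convex_on_cmul unfolding dual_fun_def by blast
qed

lemma dual_fun_affine: "dual_fun (\<lambda>x. a \<bullet> x + b)"
proof -
  have "a \<bullet> (u *\<^sub>R x + v *\<^sub>R y) + b = u * (a \<bullet> x + b) + v * (a \<bullet> y + b)"
    if "u + v = 1" for u v x y
  proof -
    have "b = u * b + v * b" using that by (metis distrib_right mult_1)
    then show ?thesis by (simp add: inner_add_right distrib_left)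
  qed
  then show ?thesis unfolding dual_fun_def convex_on_def by (metis order_refl convex_UNIV)
qed

text \<open>What \<open>Z\<close> composed with conjugation inherits: adding
  \<open>c \<bullet> x\<close> to a function translates its conjugate by \<open>c\<close>, adding
  \<open>d\<close> shifts it vertically by \<open>- d\<close>.\<close>

definition dual_valuation :: "(('a::euclidean_space \<Rightarrow> real) \<Rightarrow> real) \<Rightarrow> bool" where
  "dual_valuation F \<longleftrightarrow>
     (\<forall>a b. dual_fun a \<longrightarrow> dual_fun b \<longrightarrow> dual_fun (\<lambda>x. min (a x) (b x)) \<longrightarrow>
        F (\<lambda>x. max (a x) (b x)) + F (\<lambda>x. min (a x) (b x)) = F a + F b) \<and>
     (\<forall>v c d. dual_fun v \<longrightarrow> F (\<lambda>x. v x + (c \<bullet> x + d)) = F v)"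

lemma dual_valuation_max_min:
  "\<lbrakk>dual_valuation F; dual_fun a; dual_fun b; dual_fun (\<lambda>x. min (a x) (b x))\<rbrakk> \<Longrightarrow>
     F (\<lambda>x. max (a x) (b x)) + F (\<lambda>x. min (a x) (b x)) = F a + F b"
  unfolding dual_valuation_def by blast

lemma dual_valuation_affine:
  "\<lbrakk>dual_valuation F; dual_fun v\<rbrakk> \<Longrightarrow> F (\<lambda>x. v x + (c \<bullet> x + d)) = F v"
  unfolding dual_valuation_def by blast

text \<open>Unlike \<open>min a b\<close>, the minimum \<open>a + b + w\<close> of \<open>max a b + a + w\<close> and \<open>max a b + b + w\<close> is
  always convex.\<close>

lemma dual_valuation_product:
  assumes F: "dual_valuation F" and a: "dual_fun a" and b: "dual_fun b" and w: "dual_fun w"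
  defines "v \<equiv> \<lambda>x. max (a x) (b x)"
  shows "F (\<lambda>x. v x + (v x + w x)) + F (\<lambda>x. a x + (b x + w x)) =
    F (\<lambda>x. v x + (a x + w x)) + F (\<lambda>x. v x + (b x + w x))"
proof -
  have v: "dual_fun v" unfolding v_def using a b by (rule dual_fun_max)
  have mx: "max (v x + (a x + w x)) (v x + (b x + w x)) = v x + (v x + w x)"
   and mn: "min (v x + (a x + w x)) (v x + (b x + w x)) = a x + (b x + w x)" for x
    by (auto simp: v_def max_def min_def)
  show ?thesis
    using dual_valuation_max_min[OF F, of "\<lambda>x. v x + (a x + w x)" "\<lambda>x. v x + (b x + w x)"]
    unfolding mx mn using a b v w by (simp add: dual_fun_add)
qed

text \<open>Adding \<open>v\<close> distributes over maxima and minima and commutes with adding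
  affine functions. This lets the induction on the number of affine functions pass from
  \<open>F\<close> to a difference of \<open>F\<close>.\<close>

lemma dual_valuation_difference:
  assumes F: "dual_valuation F" and v: "dual_fun v"
  shows "dual_valuation (\<lambda>w. F (\<lambda>x. v x + w x) - F w)"
  unfolding dual_valuation_def
proof (intro conjI allI impI)
  fix a b :: "'a \<Rightarrow> real"
  assume ab: "dual_fun a" "dual_fun b" "dual_fun (\<lambda>x. min (a x) (b x))"
  have mm: "max (v x + a x) (v x + b x) = v x + max (a x) (b x)"
    "min (v x + a x) (v x + b x) = v x + min (a x) (b x)" for x
    by (auto simp: max_def min_def)
  show "F (\<lambda>x. v x + max (a x) (b x)) - F (\<lambda>x. max (a x) (b x)) +
      (F (\<lambda>x. v x + min (a x) (b x)) - F (\<lambda>x. min (a x) (b x))) =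
      F (\<lambda>x. v x + a x) - F a + (F (\<lambda>x. v x + b x) - F b)"
    using dual_valuation_max_min[OF F ab]
      dual_valuation_max_min[OF F, of "\<lambda>x. v x + a x" "\<lambda>x. v x + b x"] ab v
    by (simp add: mm dual_fun_add)
next
  fix w :: "'a \<Rightarrow> real" and c d
  assume w: "dual_fun w"
  show "F (\<lambda>x. v x + (w x + (c \<bullet> x + d))) - F (\<lambda>x. w x + (c \<bullet> x + d)) =
      F (\<lambda>x. v x + w x) - F w"
    using dual_valuation_affine[OF F w]
      dual_valuation_affine[OF F dual_fun_add[OF v w]]
    by (simp add: add.assoc)
qed

text \<open>With \<open>r = 1 / q\<close> this carries results on integer multiples over to rational
  ones.\<close>

lemma dual_valuation_scale:
  assumes F: "dual_valuation F" and r: "0 \<le> r"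
  shows "dual_valuation (\<lambda>w. F (\<lambda>x. r * w x))"
  unfolding dual_valuation_def
proof (intro conjI allI impI)
  fix a b :: "'a \<Rightarrow> real"
  assume ab: "dual_fun a" "dual_fun b" "dual_fun (\<lambda>x. min (a x) (b x))"
  have mm: "r * max (a x) (b x) = max (r * a x) (r * b x)"
    "r * min (a x) (b x) = min (r * a x) (r * b x)" for x
    using r by (simp_all add: max_mult_distrib_left min_mult_distrib_left)
  show "F (\<lambda>x. r * max (a x) (b x)) + F (\<lambda>x. r * min (a x) (b x)) =
      F (\<lambda>x. r * a x) + F (\<lambda>x. r * b x)"
    using dual_valuation_max_min[OF F dual_fun_scale[OF ab(1) r] dual_fun_scale[OF ab(2) r]]
      dual_fun_scale[OF ab(3) r] unfolding mm by simp
next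
  fix w :: "'a \<Rightarrow> real" and c d
  assume w: "dual_fun w"
  show "F (\<lambda>x. r * (w x + (c \<bullet> x + d))) = F (\<lambda>x. r * w x)"
    using dual_valuation_affine[OF F dual_fun_scale[OF w r], of "r *\<^sub>R c" "r * d"]
    by (simp add: distrib_left)
qed

section \<open>Maxima of finitely many affine functions\<close>

definition max_affine :: "('a::euclidean_space \<times> real) set \<Rightarrow> 'a \<Rightarrow> real" where
  "max_affine V x = Max ((\<lambda>p. fst p \<bullet> x + snd p) ` V)"

lemma max_affine_singleton: "max_affine {p} x = fst p \<bullet> x + snd p"
  by (simp add: max_affine_def)

lemma max_affine_insert:
  assumes "finite V" "V \<noteq> {}"
  shows "max_affine (insert p V) x = max (fst p \<bullet> x + snd p) (max_affine V x)"
  using assms by (simp add: max_affine_def)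

lemma max_affine_ge:
  assumes "finite V" "p \<in> V"
  shows "fst p \<bullet> x + snd p \<le> max_affine V x"
  using assms by (auto simp: max_affine_def)

lemma max_affine_le:
  assumes "finite V" "V \<noteq> {}" "\<And>p. p \<in> V \<Longrightarrow> fst p \<bullet> x + snd p \<le> t"
  shows "max_affine V x \<le> t"
  using assms by (auto simp: max_affine_def)

lemma dual_fun_max_affine:
  assumes "finite V" "V \<noteq> {}"
  shows "dual_fun (max_affine V)"
  using assms
proof (induction rule: finite_ne_induct)
  case (singleton p)
  show ?case using dual_fun_affine[of "fst p" "snd p"]
    by (simp add: max_affine_singleton[abs_def])
next
  case (insert p V)
  then have "max_affine (insert p V) = (\<lambda>x. max (fst p \<bullet> x + snd p) (max_affine V x))"
    by (intro ext max_affine_insert) auto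
  then show ?case
    using dual_fun_max[OF dual_fun_affine insert.IH] by simp
qed

text \<open>For the maximum \<open>v\<close> of \<open>e\<close> and an affine function, \<open>dual_valuation_product\<close> reads
  \<open>(T\<^sub>v - T\<^sub>e) (T\<^sub>v - 1) F = 0\<close>, where \<open>T\<^sub>f F = F (f + \<cdot>)\<close>. Hence, along the multiples of \<open>v\<close>,
  the difference \<open>(T\<^sub>v - 1) F\<close> agrees with its values along the multiples of \<open>e\<close>.\<close>

lemma binomial_sum_max_affine:
  assumes "finite V" "V \<noteq> {}" "dual_valuation F"
  shows "binomial_sum (card V - 1) (\<lambda>k. F (\<lambda>x. real k * max_affine V x))"
  using assms
proof (induction arbitrary: F rule: finite_ne_induct)
  case (singleton p)
  have zero: "dual_fun (\<lambda>x::'a. 0::real)" using dual_fun_affine[of "0::'a" 0] by simp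
  have "F (\<lambda>x. real k * max_affine {p} x) = F (\<lambda>x. 0)" for k
    using dual_valuation_affine[OF singleton zero, of "real k *\<^sub>R fst p" "real k * snd p"]
    by (simp add: max_affine_singleton algebra_simps)
  then show ?case by (auto intro!: binomial_sumI[where c = "\<lambda>_. F (\<lambda>x. 0)"])
next
  case (insert p V)
  define e where "e = max_affine V"
  define v where "v = max_affine (insert p V)"
  have e: "dual_fun e" and v: "dual_fun v"
    using insert by (auto simp: e_def v_def intro: dual_fun_max_affine)
  have v_eq: "v = (\<lambda>x. max (e x) (fst p \<bullet> x + snd p))"
    unfolding e_def v_def by (intro ext) (simp add: max_affine_insert insert.hyps max.commute)
  define G where "G w = F (\<lambda>x. v x + w x) - F w" for w
  have G: "dual_valuation G"
    unfolding G_def using insert.prems v by (rule dual_valuation_difference)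
  have step: "G (\<lambda>x. v x + w x) = G (\<lambda>x. e x + w x)" if w: "dual_fun w" for w
    using dual_valuation_product[OF insert.prems e dual_fun_affine[of "fst p" "snd p"] w]
      dual_valuation_affine[OF insert.prems dual_fun_add[OF e w], of "fst p" "snd p"]
      dual_valuation_affine[OF insert.prems dual_fun_add[OF v w], of "fst p" "snd p"]
    by (simp add: G_def v_eq algebra_simps)
  \<comment> \<open>The free summand \<open>w\<close> absorbs one copy of \<open>v\<close> before
    the induction hypothesis is applied; \<open>step\<close> then turns that copy into
    \<open>e\<close>.\<close>
  have iter: "G (\<lambda>x. real k * v x + w x) = G (\<lambda>x. real k * e x + w x)" if "dual_fun w" for k w
    using that
  proof (induction k arbitrary: w)
    case (Suc k)
    have "G (\<lambda>x. real (Suc k) * v x + w x) = G (\<lambda>x. real k * v x + (v x + w x))"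
      by (simp add: algebra_simps)
    also have "\<dots> = G (\<lambda>x. real k * e x + (v x + w x))"
      using Suc.IH[OF dual_fun_add[OF v Suc.prems]] .
    also have "\<dots> = G (\<lambda>x. v x + (real k * e x + w x))"
      by (simp add: algebra_simps)
    also have "\<dots> = G (\<lambda>x. e x + (real k * e x + w x))"
      by (intro step dual_fun_add dual_fun_scale e Suc.prems) simp
    also have "\<dots> = G (\<lambda>x. real (Suc k) * e x + w x)"
      by (simp add: algebra_simps)
    finally show ?case .
  qed simp
  have "G (\<lambda>x. real k * v x) = G (\<lambda>x. real k * e x)" for k
    using iter[OF dual_fun_affine[of 0 0], of k] by simp
  moreover have "F (\<lambda>x. real (Suc k) * v x) - F (\<lambda>x. real k * v x) = G (\<lambda>x. real k * v x)" for k
    by (simp add: G_def algebra_simps)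
  ultimately have "binomial_sum (card V - 1)
      (\<lambda>k. F (\<lambda>x. real (Suc k) * v x) - F (\<lambda>x. real k * v x))"
    using insert.IH[OF G] by (simp add: e_def)
  then have "binomial_sum (Suc (card V - 1)) (\<lambda>k. F (\<lambda>x. real k * v x))"
    by (rule binomial_sum_of_difference)
  moreover have "Suc (card V - 1) = card (insert p V) - 1"
    using insert by (simp add: card_gt_0_iff)
  ultimately show ?case by (simp add: v_def)
qed

section \<open>Lowering the degree to the dimension\<close>

text \<open>In terms of \<open>(slope, height)\<close> pairs this is the stellar subdivision of the edge \<open>pq\<close> at \<open>m\<close>.\<close>

lemma dual_valuation_max_affine_split:
  assumes F: "dual_valuation F" and C: "finite C" and r: "0 \<le> r"
    and s: "0 \<le> s" "s \<le> 1" and m: "m = s *\<^sub>R p + (1 - s) *\<^sub>R q"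
  shows "F (\<lambda>x. r * max_affine (insert p (insert q C)) x) =
    F (\<lambda>x. r * max_affine (insert p (insert m C)) x) +
    F (\<lambda>x. r * max_affine (insert q (insert m C)) x) -
    F (\<lambda>x. r * max_affine (insert m C) x)"
proof -
  define l where "l p x = fst p \<bullet> x + snd p" for p :: "'a \<times> real" and x
  have lm: "l m x = s * l p x + (1 - s) * l q x" for x
    by (simp add: m l_def inner_add_left algebra_simps)
  \<comment> \<open>By the upper bound, adding \<open>m\<close> to the full set does not change the
    maximum; by the lower bound, the minimum of the two maxima on the right is
    \<open>?c\<close>.\<close>
  have between: "min (l p x) (l q x) \<le> l m x" "l m x \<le> max (l p x) (l q x)" for x
    unfolding lm using s
      convex_bound_le[of "l p x" "max (l p x) (l q x)" "l q x" s "1 - s"]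
      convex_bound_le[of "- l p x" "- min (l p x) (l q x)" "- l q x" s "1 - s"] by auto
  let ?c = "max_affine (insert m C)"
  have c: "l m x \<le> ?c x" for x
    using max_affine_ge[of "insert m C" m] C by (simp add: l_def)
  have ins: "max_affine (insert z (insert m C)) x = max (l z x) (?c x)" for z x
    using C by (simp add: max_affine_insert l_def)
  have "max_affine (insert p (insert q C)) x = max (l p x) (max (l q x) (?c x))" for x
  proof (cases "C = {}")
    case True
    then show ?thesis using between[of x] by (auto simp: max_affine_insert max_affine_singleton l_def)
  next
    case False
    then show ?thesis using between[of x] C by (auto simp: max_affine_insert l_def)
  qed
  then have full: "max_affine (insert p (insert q C)) x = max (max (l p x) (?c x)) (max (l q x) (?c x))" for x
    by (simp only: max.assoc max.left_commute max.idem max.left_idem)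
  have r_max: "max (r * a) (r * b) = r * max a b" and r_min: "min (r * a) (r * b) = r * min a b" for a b
    using r by (simp_all add: max_mult_distrib_left min_mult_distrib_left)
  have mx: "max (r * max_affine (insert p (insert m C)) x) (r * max_affine (insert q (insert m C)) x)
      = r * max_affine (insert p (insert q C)) x" for x
    by (simp only: r_max ins full)
  have "min (max (l p x) (?c x)) (max (l q x) (?c x)) = ?c x" for x
    using between[of x] c[of x] by auto
  then have mn: "min (r * max_affine (insert p (insert m C)) x) (r * max_affine (insert q (insert m C)) x)
      = r * ?c x" for x
    by (simp only: r_min ins)
  have df: "dual_fun (\<lambda>x. r * max_affine (insert z W) x)" if "finite W" for z W
    using that r by (intro dual_fun_scale dual_fun_max_affine) auto
  show ?thesis
    using dual_valuation_max_min[OF F, of "\<lambda>x. r * max_affine (insert p (insert m C)) x"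
        "\<lambda>x. r * max_affine (insert q (insert m C)) x"]
      df[of "insert m C" p] df[of "insert m C" q] df[of C m] C
    unfolding mx mn by simp
qed

text \<open>If the slopes are distinct, the vectors \<open>(slope, 1)\<close> are too many to be
  independent; two functions of equal slope give the relation with coefficients 1 and -1. Changing
  all signs if necessary makes the sum of heights nonnegative, and a nonzero family with sum zero
  has a negative member.\<close>

lemma affine_relation_exists:
  fixes V :: "('a::euclidean_space \<times> real) set"
  assumes fin: "finite V" and card: "DIM('a) + 2 \<le> card V"
  obtains c p where "(\<Sum>p\<in>V. c p) = (0::real)" "(\<Sum>p\<in>V. c p *\<^sub>R fst p) = 0"
    "0 \<le> (\<Sum>p\<in>V. c p * snd p)" "p \<in> V" "c p < 0"
proof -
  have "\<exists>c. (\<Sum>p\<in>V. c p) = (0::real) \<and> (\<Sum>p\<in>V. c p *\<^sub>R fst p) = 0 \<and> (\<exists>p\<in>V. c p \<noteq> 0)"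
  proof (cases "inj_on fst V")
    case True
    define h where "h p = (fst p, 1::real)" for p :: "'a \<times> real"
    have inj: "inj_on h V" using True by (auto simp: inj_on_def h_def)
    have "dependent (h ` V)"
    proof (rule ccontr)
      assume "\<not> dependent (h ` V)"
      then have "card (h ` V) \<le> DIM('a \<times> real)" using independent_bound by blast
      then show False using card inj by (simp add: card_image)
    qed
    then obtain u where u: "\<exists>v\<in>h ` V. u v \<noteq> 0" "(\<Sum>v\<in>h ` V. u v *\<^sub>R v) = 0"
      using dependent_finite[of "h ` V"] fin by auto
    have eq: "(\<Sum>p\<in>V. u (h p) *\<^sub>R h p) = 0"
      using u(2) by (simp add: sum.reindex[OF inj])
    have "(\<Sum>p\<in>V. u (h p)) = 0" "(\<Sum>p\<in>V. u (h p) *\<^sub>R fst p) = 0"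
      using arg_cong[OF eq, of snd] arg_cong[OF eq, of fst]
      by (simp_all add: snd_sum fst_sum h_def)
    then show ?thesis using u(1) by (intro exI[of _ "\<lambda>p. u (h p)"]) auto
  next
    case False
    then obtain p q where pq: "p \<in> V" "q \<in> V" "p \<noteq> q" "fst p = fst q"
      by (auto simp: inj_on_def)
    define c where "c r = (if r = p then 1 else 0) - (if r = q then 1 else (0::real))" for r
    have "(\<Sum>r\<in>V. c r) = 0"
      using pq fin by (simp add: c_def sum_subtractf)
    moreover have "(\<Sum>r\<in>V. c r *\<^sub>R fst r) = 0"
      using pq fin by (simp add: c_def scaleR_diff_left sum_subtractf if_distrib[of "\<lambda>z. z *\<^sub>R _"] cong: if_cong)
    moreover have "c p \<noteq> 0" using pq by (simp add: c_def)
    ultimately show ?thesis using pq(1) by blast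
  qed
  then obtain c where c: "(\<Sum>p\<in>V. c p) = (0::real)" "(\<Sum>p\<in>V. c p *\<^sub>R fst p) = 0" "\<exists>p\<in>V. c p \<noteq> 0"
    by blast
  have neg: "\<exists>p\<in>V. b p < 0" if "(\<Sum>p\<in>V. b p) = (0::real)" "\<exists>p\<in>V. b p \<noteq> 0" for b
    using that sum_nonneg_eq_0_iff[OF fin, of b] by (meson not_le)
  show ?thesis
  proof (cases "0 \<le> (\<Sum>p\<in>V. c p * snd p)")
    case True
    then show ?thesis using c neg[of c] that[of c] by blast
  next
    case False
    then show ?thesis using c neg[of "\<lambda>p. - c p"] that[of "\<lambda>p. - c p"]
      by (auto simp: sum_negf)
  qed
qed

text \<open>Evaluated at \<open>x\<close>, the relation bounds \<open>- c p\<close> times the affine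
  function of \<open>p\<close> by a nonnegative combination of the others with total weight
  \<open>- c p\<close>, hence by \<open>- c p\<close> times their maximum.\<close>

lemma max_affine_remove:
  assumes V: "finite V" "p \<in> V" and p: "c p < 0" and others: "\<And>q. q \<in> V - {p} \<Longrightarrow> 0 \<le> c q"
    and rel: "(\<Sum>p\<in>V. c p) = (0::real)" "(\<Sum>p\<in>V. c p *\<^sub>R fst p) = 0" "0 \<le> (\<Sum>p\<in>V. c p * snd p)"
  shows "V - {p} \<noteq> {} \<and> max_affine V = max_affine (V - {p})"
proof
  have rest: "(\<Sum>q\<in>V - {p}. c q) = - c p"
    using sum.remove[OF V, of c] rel(1) by linarith
  show ne: "V - {p} \<noteq> {}"
  proof
    assume "V - {p} = {}"
    then show False using rest p by (simp only: sum.empty)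
  qed
  show "max_affine V = max_affine (V - {p})"
  proof
    fix x
    let ?M = "max_affine (V - {p}) x"
    have "(\<Sum>q\<in>V. c q *\<^sub>R fst q) \<bullet> x + (\<Sum>q\<in>V. c q * snd q) = (\<Sum>q\<in>V. c q * (fst q \<bullet> x + snd q))"
      by (simp add: inner_sum_left distrib_left sum.distrib)
    then have "0 \<le> (\<Sum>q\<in>V. c q * (fst q \<bullet> x + snd q))"
      using rel by simp
    also have "\<dots> = c p * (fst p \<bullet> x + snd p) + (\<Sum>q\<in>V - {p}. c q * (fst q \<bullet> x + snd q))"
      using V by (simp add: sum.remove)
    also have "(\<Sum>q\<in>V - {p}. c q * (fst q \<bullet> x + snd q)) \<le> (\<Sum>q\<in>V - {p}. c q * ?M)"
      using V others by (intro sum_mono mult_left_mono max_affine_ge) auto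
    also have "(\<Sum>q\<in>V - {p}. c q * ?M) = - c p * ?M"
      using rest by (simp flip: sum_distrib_right)
    finally have "c p * ?M \<le> c p * (fst p \<bullet> x + snd p)"
      by simp
    then have "fst p \<bullet> x + snd p \<le> ?M"
      using p by (simp only: mult_le_cancel_left_neg)
    then show "max_affine V x = ?M"
      using max_affine_insert[of "V - {p}" p x] V ne by (simp add: insert_absorb)
  qed
qed

text \<open>The relation puts a convex combination of the affine functions with negative coefficient below
  a convex combination of those with positive coefficient. Replacing two of the former by their barycentre lowers the number
  of negative coefficients; once there is only one, its function is redundant.\<close>

lemma binomial_sum_reduction:
  fixes V :: "('a::euclidean_space \<times> real) set"
  assumes F: "dual_valuation F"
    and small: "\<And>W. \<lbrakk>finite W; W \<noteq> {}; card W < N\<rbrakk> \<Longrightarrow>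
      binomial_sum d (\<lambda>k. F (\<lambda>x. real k * max_affine W x))"
    and V: "finite V" "card V = N"
    and rel: "(\<Sum>p\<in>V. c p) = (0::real)" "(\<Sum>p\<in>V. c p *\<^sub>R fst p) = 0" "0 \<le> (\<Sum>p\<in>V. c p * snd p)"
    and neg: "p \<in> V" "c p < 0"
  shows "binomial_sum d (\<lambda>k. F (\<lambda>x. real k * max_affine V x))"
  using V rel neg
proof (induction "card {p \<in> V. c p < 0}" arbitrary: V c p rule: less_induct)
  case less
  show ?case
  proof (cases "\<exists>q\<in>V - {p}. c q < 0")
    case False
    then have "V - {p} \<noteq> {} \<and> max_affine V = max_affine (V - {p})"
      using less.prems by (intro max_affine_remove[where c = c]) (auto simp: not_less)
    moreover have "card (V - {p}) < N"
      using less.prems by (metis card_Diff1_less)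
    ultimately show ?thesis using small[of "V - {p}"] less.prems by auto
  next
    case True
    then obtain q where q: "q \<in> V" "q \<noteq> p" "c q < 0" by blast
    define C where "C = V - {p, q}"
    have C: "finite C" "p \<notin> C" "q \<notin> C" "V = insert p (insert q C)"
      using q less.prems by (auto simp: C_def)
    have cardC: "card C + 2 = N"
      using C q less.prems(2) by simp
    \<comment> \<open>This weight makes \<open>(c p + c q) *\<^sub>R m\<close> equal to
      \<open>c p *\<^sub>R p + c q *\<^sub>R q\<close>, so \<open>m\<close> can take over both
      coefficients.\<close>
    define s where "s = c p / (c p + c q)"
    define m where "m = s *\<^sub>R p + (1 - s) *\<^sub>R q"
    have cpq: "c p + c q \<noteq> 0" and s: "0 \<le> s" "s \<le> 1"
      using q less.prems by (auto simp: s_def divide_simps)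
    have one_s: "1 - s = c q / (c p + c q)" using cpq by (simp add: s_def field_simps)
    have m_eq: "(c p + c q) *\<^sub>R m = c p *\<^sub>R p + c q *\<^sub>R q"
      unfolding m_def one_s unfolding s_def using cpq by (simp add: scaleR_add_right)
    have half: "binomial_sum d (\<lambda>k. F (\<lambda>x. real k * max_affine (insert z (insert m C)) x))"
      if z: "z \<in> {p, q}" for z
    \<comment> \<open>If \<open>m\<close> is already present, the set is smaller than
      \<open>V\<close>; otherwise it is as large, but with one negative coefficient less.\<close>
    proof (cases "m \<in> insert z C")
      case True
      then have "card (insert z (insert m C)) \<le> Suc (card C)"
        using C by (cases "m = z") (auto simp: insert_absorb card_insert_if)
      then show ?thesis using C cardC by (intro small) auto
    next
      case False
      \<comment> \<open>The point \<open>z\<close> stays in the set with coefficient 0; the other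
        one of \<open>p\<close> and \<open>q\<close> has left it.\<close>
      define b where "b = c(z := 0, m := c p + c q)"
      have zm: "z \<noteq> m" "z \<notin> C" "m \<notin> C" using False z C by auto
      have bC: "b r = c r" if "r \<in> C" for r using that zm by (auto simp: b_def)
      have sums: "(\<Sum>r\<in>insert z (insert m C). b r *\<^sub>R g r) = (\<Sum>r\<in>V. c r *\<^sub>R g r)"
        if "(c p + c q) *\<^sub>R g m = c p *\<^sub>R g p + c q *\<^sub>R g q" for g :: "'a \<times> real \<Rightarrow> 'b::real_vector"
      proof -
        have "(\<Sum>r\<in>C. b r *\<^sub>R g r) = (\<Sum>r\<in>C. c r *\<^sub>R g r)" using bC by simp
        then show ?thesis using C zm q that by (simp add: b_def add.assoc)
      qed
      have "{r \<in> insert z (insert m C). b r < 0} = insert m {r \<in> C. c r < 0}"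
        using zm bC q(3) less.prems(7) by (auto simp: b_def)
      moreover have "{r \<in> V. c r < 0} = insert p (insert q {r \<in> C. c r < 0})"
        using C q less.prems by auto
      ultimately have fewer: "card {r \<in> insert z (insert m C). b r < 0} < card {r \<in> V. c r < 0}"
        using C q zm by simp
      show ?thesis
      proof (rule less.hyps[OF fewer])
        show "finite (insert z (insert m C))" "card (insert z (insert m C)) = N"
          using C zm cardC by auto
        show "(\<Sum>r\<in>insert z (insert m C). b r) = 0"
          using sums[of "\<lambda>_. 1::real"] less.prems(3) by simp
        show "(\<Sum>r\<in>insert z (insert m C). b r *\<^sub>R fst r) = 0"
          using sums[of fst] arg_cong[OF m_eq, of fst] less.prems(4) by simp
        show "0 \<le> (\<Sum>r\<in>insert z (insert m C). b r * snd r)"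
          using sums[of snd] arg_cong[OF m_eq, of snd] less.prems(5) by simp
        show "m \<in> insert z (insert m C)" "b m < 0"
          using q less.prems by (auto simp: b_def)
      qed
    qed
    have third: "binomial_sum d (\<lambda>k. F (\<lambda>x. real k * max_affine (insert m C) x))"
      using C cardC by (intro small) (auto simp: card_insert_if)
    have "binomial_sum d (\<lambda>k. F (\<lambda>x. real k * max_affine (insert p (insert m C)) x)
      + F (\<lambda>x. real k * max_affine (insert q (insert m C)) x)
      + - F (\<lambda>x. real k * max_affine (insert m C) x))"
      by (intro binomial_sum_add binomial_sum_uminus half third) auto
    then show ?thesis
      using dual_valuation_max_affine_split[OF F C(1) _ s m_def] by (simp add: C(4))
  qed
qed

text \<open>For up to \<open>DIM('a) + 1\<close> functions their number already bounds the degree;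
  beyond that there is an affine relation, and the reduction leads to smaller sets.\<close>

lemma binomial_sum_max_affine_DIM:
  fixes V :: "('a::euclidean_space \<times> real) set"
  assumes F: "dual_valuation F" and "finite V" "V \<noteq> {}"
  shows "binomial_sum DIM('a) (\<lambda>k. F (\<lambda>x. real k * max_affine V x))"
  using assms(2,3)
proof (induction "card V" arbitrary: V rule: less_induct)
  case less
  show ?case
  proof (cases "card V \<le> DIM('a) + 1")
    case True
    then show ?thesis
      using binomial_sum_mono[OF binomial_sum_max_affine[OF less.prems F]] by simp
  next
    case False
    then have large: "DIM('a) + 2 \<le> card V" by simp
    obtain c p where rel: "(\<Sum>p\<in>V. c p) = (0::real)" "(\<Sum>p\<in>V. c p *\<^sub>R fst p) = 0"
      "0 \<le> (\<Sum>p\<in>V. c p * snd p)" "p \<in> V" "c p < 0"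
      by (rule affine_relation_exists[OF less.prems(1) large])
    show ?thesis
      by (rule binomial_sum_reduction[OF F less.hyps less.prems(1) refl rel])
  qed
qed

section \<open>Conjugation\<close>

lemma Conv_convex:
  assumes "u \<in> Conv" "0 \<le> t" "t \<le> 1"
  shows "u ((1 - t) *\<^sub>R x + t *\<^sub>R y) \<le> ereal (1 - t) * u x + ereal t * u y"
  using assms unfolding Conv_def by auto

lemma Conv_scD: "u \<in> Conv_sc \<Longrightarrow> u \<in> Conv"
  unfolding Conv_sc_def by auto

lemma Conv_sc_tendsto:
  "u \<in> Conv_sc \<Longrightarrow> ((\<lambda>x. u x / ereal (norm x)) \<longlongrightarrow> \<infinity>) at_infinity"
  unfolding Conv_sc_def by auto

text \<open>\<open>Conv\<close> states semicontinuity with the punctured filter \<open>at x\<close>;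
  where \<open>X k = x\<close> the bound is trivial.\<close>

lemma Conv_liminf:
  assumes u: "u \<in> Conv" and X: "X \<longlonglongrightarrow> x"
  shows "u x \<le> liminf (\<lambda>k. u (X k))"
  unfolding le_Liminf_iff
proof (intro allI impI)
  fix t
  assume t: "t < u x"
  have "u x \<le> Liminf (at x) u" using u unfolding Conv_def by auto
  then have "eventually (\<lambda>y. t < u y) (at x)"
    using t by (auto simp: le_Liminf_iff)
  then have "eventually (\<lambda>y. y \<noteq> x \<longrightarrow> t < u y) (nhds x)"
    by (simp add: eventually_at_filter)
  then have "eventually (\<lambda>y. t < u y) (nhds x)"
    by (rule eventually_mono) (use t in auto)
  then show "eventually (\<lambda>k. t < u (X k)) sequentially"
    using X by (rule eventually_compose_filterlim)
qed

definition conjugate :: "(real ^ 'n \<Rightarrow> real) \<Rightarrow> real ^ 'n \<Rightarrow> ereal" where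
  "conjugate v y = (SUP x. ereal (x \<bullet> y - v x))"

lemma conjugate_upper: "ereal (x \<bullet> y - v x) \<le> conjugate v y"
  unfolding conjugate_def by (rule SUP_upper) simp

lemma conjugate_least: "(\<And>x. ereal (x \<bullet> y - v x) \<le> t) \<Longrightarrow> conjugate v y \<le> t"
  unfolding conjugate_def by (rule SUP_least)

lemma conjugate_not_MInf: "conjugate v y \<noteq> -\<infinity>"
  using conjugate_upper[of 0 y v] by auto

text \<open>A supremum of affine functions is convex and lower semicontinuous; it is finite at the
  slope of an affine minorant of \<open>v\<close>.\<close>

lemma conjugate_in_Conv:
  assumes v: "dual_fun v"
  shows "conjugate v \<in> Conv"
proof -
  obtain a b where ab: "\<And>x. a \<bullet> x + b \<le> v x"
    using v unfolding dual_fun_def by auto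
  have "conjugate v a \<le> ereal (- b)"
    using ab by (intro conjugate_least) (smt (verit) ereal_less_eq(3) inner_commute)
  then have "conjugate v a \<noteq> \<infinity>" by auto
  moreover have "conjugate v ((1 - t) *\<^sub>R x + t *\<^sub>R y) \<le>
      ereal (1 - t) * conjugate v x + ereal t * conjugate v y"
    if t: "t \<in> {0..1}" for x y t
  proof (rule conjugate_least)
    fix z
    have "ereal (z \<bullet> ((1 - t) *\<^sub>R x + t *\<^sub>R y) - v z) =
        ereal (1 - t) * ereal (z \<bullet> x - v z) + ereal t * ereal (z \<bullet> y - v z)"
      by (simp add: inner_add_right algebra_simps)
    also have "\<dots> \<le> ereal (1 - t) * conjugate v x + ereal t * conjugate v y"
      using t by (intro add_mono ereal_mult_left_mono conjugate_upper) auto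
    finally show "ereal (z \<bullet> ((1 - t) *\<^sub>R x + t *\<^sub>R y) - v z) \<le>
      ereal (1 - t) * conjugate v x + ereal t * conjugate v y" .
  qed
  moreover have "conjugate v x \<le> Liminf (at x) (conjugate v)" for x
  proof (rule conjugate_least)
    fix z
    have "((\<lambda>y. ereal (z \<bullet> y - v z)) \<longlongrightarrow> ereal (z \<bullet> x - v z)) (at x)"
      by (intro tendsto_intros)
    then have "ereal (z \<bullet> x - v z) = Liminf (at x) (\<lambda>y. ereal (z \<bullet> y - v z))"
      by (rule lim_imp_Liminf[OF at_neq_bot, symmetric])
    also have "\<dots> \<le> Liminf (at x) (conjugate v)"
      by (intro Liminf_mono always_eventually allI conjugate_upper)
    finally show "ereal (z \<bullet> x - v z) \<le> Liminf (at x) (conjugate v)" .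
  qed
  ultimately show ?thesis
    using conjugate_not_MInf unfolding Conv_def by blast
qed

text \<open>Super-coercivity reflects that \<open>v\<close> is finite: if \<open>M\<close> bounds
  \<open>v\<close> on the ball of radius \<open>R\<close>, testing the supremum at the positive
  multiple of \<open>y\<close> of norm \<open>R\<close> gives the lower bound
  \<open>R * norm y - M\<close>.\<close>

lemma conjugate_in_Conv_sc:
  assumes v: "dual_fun v"
  shows "conjugate v \<in> Conv_sc"
proof -
  have "eventually (\<lambda>y. ereal r < conjugate v y / ereal (norm y)) at_infinity" for r
  proof -
    \<comment> \<open>The extra 1 leaves a spare \<open>norm y\<close>, which exceeds
      \<open>M\<close> for \<open>norm y\<close> at least \<open>\<bar>M\<bar> + 1\<close>.\<close>
    define R where "R = \<bar>r\<bar> + 1"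
    have "continuous_on UNIV v"
      using v convex_on_continuous[OF open_UNIV] unfolding dual_fun_def by blast
    then have "bounded (v ` cball 0 R)"
      by (intro compact_imp_bounded compact_continuous_image) (auto intro: continuous_on_subset)
    then obtain M where M: "\<And>x. x \<in> cball 0 R \<Longrightarrow> norm (v x) \<le> M"
      unfolding bounded_iff by blast
    have "ereal r < conjugate v y / ereal (norm y)" if y: "\<bar>M\<bar> + 1 \<le> norm y" for y
    proof -
      have pos: "0 < norm y" using y by linarith
      define z where "z = (R / norm y) *\<^sub>R y"
      have "norm z = R" using pos by (simp add: z_def R_def)
      then have "v z \<le> M" using M[of z] by auto
      moreover have "z \<bullet> y = R * norm y"
        using pos by (simp add: z_def dot_square_norm power2_eq_square)
      moreover have "r * norm y + norm y \<le> R * norm y"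
        using pos by (simp add: R_def algebra_simps)
      ultimately have "r * norm y < z \<bullet> y - v z" using y by linarith
      then have "ereal (r * norm y) < conjugate v y"
        using conjugate_upper[of z y v] by (meson ereal_less_eq(3) less_ereal.simps(1) less_le_trans)
      then show ?thesis using pos by (cases "conjugate v y") (auto simp: field_simps)
    qed
    then show ?thesis by (auto simp: eventually_at_infinity)
  qed
  then show ?thesis
    using conjugate_in_Conv[OF v] unfolding Conv_sc_def by (simp add: tendsto_PInfty)
qed

lemma conjugate_antimono:
  assumes "\<And>x. v x \<le> w x"
  shows "conjugate w y \<le> conjugate v y"
proof (rule conjugate_least)
  fix x
  have "ereal (x \<bullet> y - w x) \<le> ereal (x \<bullet> y - v x)" using assms[of x] by simp
  then show "ereal (x \<bullet> y - w x) \<le> conjugate v y" using conjugate_upper order.trans by blast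
qed

lemma conjugate_min: "conjugate (\<lambda>x. min (a x) (b x)) y = max (conjugate a y) (conjugate b y)"
proof (rule antisym)
  show "conjugate (\<lambda>x. min (a x) (b x)) y \<le> max (conjugate a y) (conjugate b y)"
  proof (rule conjugate_least)
    fix x
    show "ereal (x \<bullet> y - min (a x) (b x)) \<le> max (conjugate a y) (conjugate b y)"
      using conjugate_upper[of x y a] conjugate_upper[of x y b] by (auto simp: min_def le_max_iff_disj)
  qed
  have "conjugate a y \<le> conjugate (\<lambda>x. min (a x) (b x)) y"
    by (rule conjugate_antimono) simp
  moreover have "conjugate b y \<le> conjugate (\<lambda>x. min (a x) (b x)) y"
    by (rule conjugate_antimono) simp
  ultimately show "max (conjugate a y) (conjugate b y) \<le> conjugate (\<lambda>x. min (a x) (b x)) y"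
    by simp
qed

text \<open>If an affine function \<open>l\<close> lies below \<open>max a b\<close>, then the sets \<open>a < l\<close> and \<open>b < l\<close> are open,
  convex and disjoint. Both being nonempty, a segment joining them would contain a point outside
  their union, where convexity of \<open>min a b\<close> fails.\<close>

lemma affine_le_max_cases:
  fixes a b :: "real ^ 'n \<Rightarrow> real"
  assumes a: "dual_fun a" and b: "dual_fun b" and ab: "dual_fun (\<lambda>x. min (a x) (b x))"
    and le: "\<And>x. x \<bullet> y - s \<le> max (a x) (b x)"
  shows "(\<forall>x. x \<bullet> y - s \<le> a x) \<or> (\<forall>x. x \<bullet> y - s \<le> b x)"
proof (rule ccontr)
  assume "\<not> ?thesis"
  then obtain p q where p: "a p < p \<bullet> y - s" and q: "b q < q \<bullet> y - s"
    by (auto simp: not_le)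
  have cont: "continuous_on UNIV a" "continuous_on UNIV b"
    using a b convex_on_continuous[OF open_UNIV] unfolding dual_fun_def by blast+
  define A where "A = {x. a x < x \<bullet> y - s}"
  define B where "B = {x. b x < x \<bullet> y - s}"
  have "open A" "open B"
    unfolding A_def B_def by (intro open_Collect_less cont continuous_intros)+
  moreover have "A \<inter> B \<inter> closed_segment p q = {}"
    using le by (fastforce simp: A_def B_def not_less[symmetric])
  moreover have "A \<inter> closed_segment p q \<noteq> {}" "B \<inter> closed_segment p q \<noteq> {}"
    using p q by (auto simp: A_def B_def)
  ultimately have "\<not> closed_segment p q \<subseteq> A \<union> B"
    using connectedD[of "closed_segment p q" A B] connected_segment by blast
  then obtain x where seg: "x \<in> closed_segment p q" and "x \<notin> A" "x \<notin> B"
    by blast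
  then have x: "x \<bullet> y - s \<le> a x" "x \<bullet> y - s \<le> b x"
    by (auto simp: A_def B_def)
  from seg obtain t where t: "0 \<le> t" "t \<le> 1" "x = (1 - t) *\<^sub>R p + t *\<^sub>R q"
    by (auto simp: closed_segment_def)
  have "min (a x) (b x) \<le> (1 - t) * min (a p) (b p) + t * min (a q) (b q)"
    using ab t unfolding dual_fun_def by (auto simp: convex_on_def)
  also have "\<dots> < (1 - t) * (p \<bullet> y - s) + t * (q \<bullet> y - s)"
  proof -
    have "min (a p) (b p) < p \<bullet> y - s" "min (a q) (b q) < q \<bullet> y - s" using p q by auto
    then show ?thesis using t
      by (smt (verit) mult_less_cancel_left_pos mult_left_mono)
  qed
  also have "\<dots> = x \<bullet> y - s"
    by (simp add: t(3) inner_add_left algebra_simps)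
  finally show False using x by linarith
qed

text \<open>If the left side is a real \<open>s\<close>, the affine function
  \<open>x \<bullet> y - s\<close> of \<open>x\<close> lies below \<open>max a b\<close>, hence
  below \<open>a\<close> or below \<open>b\<close>, as \<open>min a b\<close> is convex. The other
  inequality is monotonicity.\<close>

lemma conjugate_max:
  assumes a: "dual_fun a" and b: "dual_fun b" and ab: "dual_fun (\<lambda>x. min (a x) (b x))"
  shows "conjugate (\<lambda>x. max (a x) (b x)) y = min (conjugate a y) (conjugate b y)"
proof (rule antisym)
  show "conjugate (\<lambda>x. max (a x) (b x)) y \<le> min (conjugate a y) (conjugate b y)"
    by (intro min.boundedI conjugate_antimono) auto
  show "min (conjugate a y) (conjugate b y) \<le> conjugate (\<lambda>x. max (a x) (b x)) y"
  proof (cases "conjugate (\<lambda>x. max (a x) (b x)) y")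
    case (real s)
    have "x \<bullet> y - s \<le> max (a x) (b x)" for x
      using conjugate_upper[of x y "\<lambda>x. max (a x) (b x)"] unfolding real by (simp add: algebra_simps)
    then have "(\<forall>x. x \<bullet> y - s \<le> a x) \<or> (\<forall>x. x \<bullet> y - s \<le> b x)"
      by (rule affine_le_max_cases[OF a b ab])
    then have "conjugate a y \<le> ereal s \<or> conjugate b y \<le> ereal s"
    proof (elim disj_forward)
      show "conjugate a y \<le> ereal s" if "\<forall>x. x \<bullet> y - s \<le> a x"
        using that by (intro conjugate_least) (simp add: algebra_simps)
      show "conjugate b y \<le> ereal s" if "\<forall>x. x \<bullet> y - s \<le> b x"
        using that by (intro conjugate_least) (simp add: algebra_simps)
    qed
    then show ?thesis unfolding real by (auto simp: min_le_iff_disj)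
  qed (use conjugate_not_MInf in auto)
qed

lemma conjugate_add_affine:
  "conjugate (\<lambda>x. v x + (c \<bullet> x + d)) = (\<lambda>y. conjugate v (y - c) + ereal (- d))"
proof
  fix y
  have "(SUP x. ereal (x \<bullet> (y - c) - v x) + ereal (- d)) = conjugate v (y - c) + ereal (- d)"
    unfolding conjugate_def by (rule SUP_ereal_add_left) auto
  then show "conjugate (\<lambda>x. v x + (c \<bullet> x + d)) y = conjugate v (y - c) + ereal (- d)"
    by (simp add: conjugate_def inner_diff_right inner_commute algebra_simps)
qed

lemma conjugate_scale:
  assumes "0 < r"
  shows "conjugate (\<lambda>x. r * v x) = epi_mult r (conjugate v)"
proof
  fix y
  have "(SUP x. ereal r * ereal (x \<bullet> (y /\<^sub>R r) - v x)) = epi_mult r (conjugate v) y"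
    unfolding epi_mult_def conjugate_def by (rule Sup_ereal_mult_left'[symmetric]) (use assms in auto)
  moreover have "ereal r * ereal (x \<bullet> (y /\<^sub>R r) - v x) = ereal (x \<bullet> y - r * v x)" for x
    using assms by (simp add: right_diff_distrib)
  ultimately show "conjugate (\<lambda>x. r * v x) y = epi_mult r (conjugate v) y"
    by (simp only: conjugate_def)
qed

lemma valuationD:
  "\<lbrakk>valuation F Z; u \<in> F; v \<in> F; (\<lambda>x. max (u x) (v x)) \<in> F; (\<lambda>x. min (u x) (v x)) \<in> F\<rbrakk> \<Longrightarrow>
    Z (\<lambda>x. max (u x) (v x)) + Z (\<lambda>x. min (u x) (v x)) = Z u + Z v"
  unfolding valuation_def by blast

text \<open>Conjugation exchanges maxima and minima as long as the minimum is convex.\<close>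

lemma dual_valuation_conjugate:
  assumes val: "valuation Conv_sc Z" and inv: "epi_translation_invariant Conv_sc Z"
  shows "dual_valuation (\<lambda>v. Z (conjugate v))"
  unfolding dual_valuation_def
proof (intro conjI allI impI)
  fix a b :: "real ^ 'a \<Rightarrow> real"
  assume ab: "dual_fun a" "dual_fun b" "dual_fun (\<lambda>x. min (a x) (b x))"
  have mx: "conjugate (\<lambda>x. max (a x) (b x)) = (\<lambda>y. min (conjugate a y) (conjugate b y))"
    using conjugate_max[OF ab] by blast
  have mn: "conjugate (\<lambda>x. min (a x) (b x)) = (\<lambda>y. max (conjugate a y) (conjugate b y))"
    using conjugate_min by blast
  show "Z (conjugate (\<lambda>x. max (a x) (b x))) + Z (conjugate (\<lambda>x. min (a x) (b x))) =
      Z (conjugate a) + Z (conjugate b)"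
    using valuationD[OF val conjugate_in_Conv_sc[OF ab(1)] conjugate_in_Conv_sc[OF ab(2)]]
      conjugate_in_Conv_sc[OF dual_fun_max[OF ab(1,2)]] conjugate_in_Conv_sc[OF ab(3)]
    unfolding mx mn by simp
next
  fix v :: "real ^ 'a \<Rightarrow> real" and c d
  assume v: "dual_fun v"
  \<comment> \<open>Height 0 gives the pure translate of \<open>conjugate v\<close>, which must lie
    in \<open>Conv_sc\<close> before vertical invariance can be applied to it.\<close>
  have "conjugate (\<lambda>x. v x + (c \<bullet> x + 0)) \<in> Conv_sc"
    by (intro conjugate_in_Conv_sc dual_fun_add v dual_fun_affine)
  then show "Z (conjugate (\<lambda>x. v x + (c \<bullet> x + d))) = Z (conjugate v)"
    using inv conjugate_in_Conv_sc[OF v]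
    unfolding epi_translation_invariant_def translation_invariant_def
      vertically_translation_invariant_def conjugate_add_affine by simp
qed

section \<open>Epi-convergence and epi-multiplication\<close>

lemma conjugate_max_affine_le:
  assumes "finite V" "p \<in> V"
  shows "conjugate (max_affine V) (fst p) \<le> ereal (- snd p)"
proof (rule conjugate_least)
  fix x
  show "ereal (x \<bullet> fst p - max_affine V x) \<le> ereal (- snd p)"
    using max_affine_ge[OF assms, of x] by (simp add: inner_commute)
qed

lemma convex_epigraph:
  assumes "u \<in> Conv"
  shows "convex {(x, s::real). u x \<le> ereal s}"
  unfolding convex_alt
proof (clarsimp)
  fix x y :: "real ^ 'a" and s r t :: real
  assume *: "u x \<le> ereal s" "u y \<le> ereal r" "0 \<le> t" "t \<le> 1"
  have "u ((1 - t) *\<^sub>R x + t *\<^sub>R y) \<le> ereal (1 - t) * u x + ereal t * u y"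
    using Conv_convex[OF assms *(3,4)] .
  also have "\<dots> \<le> ereal (1 - t) * ereal s + ereal t * ereal r"
    using * by (intro add_mono ereal_mult_left_mono) auto
  finally show "u ((1 - t) *\<^sub>R x + t *\<^sub>R y) \<le> ereal ((1 - t) * s + t * r)" by simp
qed

text \<open>A point below the graph of \<open>u\<close> spans a vertical ray which is separated from the convex hull
  of the given points of the epigraph; if the separating hyperplane is vertical (\<open>r = 0\<close>), a large
  multiple of its normal serves as the slope.\<close>

lemma conjugate_max_affine_ge:
  assumes u: "u \<in> Conv" and V: "finite V" "V \<noteq> {}"
    and below: "\<And>p. p \<in> V \<Longrightarrow> u (fst p) \<le> ereal (- snd p)"
  shows "u y \<le> conjugate (max_affine V) y"
proof (rule ccontr)
  assume "\<not> u y \<le> conjugate (max_affine V) y"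
  then obtain t where t: "conjugate (max_affine V) y < ereal t" "ereal t < u y"
    using ereal_dense2 by (metis not_le)
  define K where "K = convex hull ((\<lambda>p. (fst p, - snd p)) ` V)"
  define R where "R = {y} \<times> {..t}"
  have "K \<subseteq> {(x, s). u x \<le> ereal s}"
    unfolding K_def using below by (intro hull_minimal convex_epigraph[OF u]) auto
  moreover have "\<not> u y \<le> ereal s" if "s \<le> t" for s
    using that t(2) by (meson ereal_less_eq(3) not_le order.trans)
  ultimately have disj: "K \<inter> R = {}"
    by (auto simp: R_def)
  obtain h b where sep: "\<forall>x\<in>K. h \<bullet> x < b" "\<forall>x\<in>R. b < h \<bullet> x"
    using separating_hyperplane_compact_closed[of K R] disj V
    by (auto simp: K_def R_def convex_convex_hull compact_convex_hull finite_imp_compact convex_Times closed_Times)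
  obtain a r where h: "h = (a, r)" by (cases h)
  have K: "a \<bullet> fst p - r * snd p < b" if "p \<in> V" for p
  proof -
    have "(fst p, - snd p) \<in> K" unfolding K_def using that by (auto intro!: hull_inc)
    then show ?thesis using sep(1) h by fastforce
  qed
  have R: "b < a \<bullet> y + r * s" if "s \<le> t" for s
    using sep(2) that by (fastforce simp: R_def h)
  \<comment> \<open>For positive \<open>r\<close> the functional \<open>h\<close> would be unbounded
    below on the downward ray.\<close>
  have "r \<le> 0"
  proof (rule ccontr)
    assume "\<not> r \<le> 0"
    then have r: "0 < r" by simp
    define s where "s = min t ((b - a \<bullet> y) / r)"
    have "r * s \<le> b - a \<bullet> y"
      using r by (simp add: s_def min_def field_simps)
    moreover have "b < a \<bullet> y + r * s" by (rule R) (simp add: s_def)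
    ultimately show False by linarith
  qed
  have "\<exists>x. max_affine V x \<le> x \<bullet> y - t"
  proof (cases "r = 0")
    case True
    define \<delta> where "\<delta> = a \<bullet> y - b"
    have \<delta>: "0 < \<delta>" using R[of t] True by (simp add: \<delta>_def)
    define M where "M = Max (snd ` V)"
    have M: "snd p \<le> M" if "p \<in> V" for p using that V by (simp add: M_def)
    \<comment> \<open>The gain \<open>k * \<delta>\<close> pays for both \<open>t\<close> and the
      largest height \<open>M\<close>.\<close>
    define k where "k = (\<bar>t\<bar> + \<bar>M\<bar>) / \<delta>"
    have k: "0 \<le> k" "k * \<delta> = \<bar>t\<bar> + \<bar>M\<bar>" using \<delta> by (auto simp: k_def)
    have "max_affine V (k *\<^sub>R a) \<le> (k *\<^sub>R a) \<bullet> y - t"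
    proof (rule max_affine_le[OF V])
      fix p assume p: "p \<in> V"
      have "k * (a \<bullet> fst p) \<le> k * b"
        using K[OF p] True k(1) by (intro mult_left_mono) auto
      moreover have "k * (a \<bullet> y) = k * b + (\<bar>t\<bar> + \<bar>M\<bar>)"
        using k(2) by (simp add: \<delta>_def algebra_simps)
      ultimately have "k * (a \<bullet> fst p) + snd p \<le> k * (a \<bullet> y) - t"
        using M[OF p] by linarith
      then show "fst p \<bullet> (k *\<^sub>R a) + snd p \<le> (k *\<^sub>R a) \<bullet> y - t"
        by (simp add: inner_commute)
    qed
    then show ?thesis by blast
  next
    case False
    then have r: "0 < - r" using \<open>r \<le> 0\<close> by simp
    define x where "x = (1 / - r) *\<^sub>R a"
    have ax: "a \<bullet> z = - r * (x \<bullet> z)" for z using r by (simp add: x_def)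
    have "max_affine V x \<le> x \<bullet> y - t"
    proof (rule max_affine_le[OF V])
      fix p assume p: "p \<in> V"
      have "- r * (x \<bullet> fst p + snd p) < - r * (x \<bullet> y - t)"
        using K[OF p] R[of t] unfolding ax by (simp add: algebra_simps)
      then have "x \<bullet> fst p + snd p < x \<bullet> y - t"
        using r by (simp only: mult_less_cancel_left_pos)
      then show "fst p \<bullet> x + snd p \<le> x \<bullet> y - t" by (simp add: inner_commute)
    qed
    then show ?thesis by blast
  qed
  then obtain x where "max_affine V x \<le> x \<bullet> y - t" by blast
  then have "ereal t \<le> ereal (x \<bullet> y - max_affine V x)" by simp
  also have "\<dots> \<le> conjugate (max_affine V) y" by (rule conjugate_upper)
  finally show False using t(1) by simp
qed

text \<open>The slopes and heights are the first points of a sequence dense in the graph of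
  \<open>u\<close> where it is finite. The conjugates lie above \<open>u\<close>, which gives the
  liminf inequality, and agree with \<open>u\<close> at the slopes used, which gives recovery
  sequences.\<close>

lemma Conv_approximation:
  assumes u: "u \<in> Conv"
  obtains V :: "nat \<Rightarrow> ((real ^ 'n) \<times> real) set"
  where "\<And>k. finite (V k)" "\<And>k. V k \<noteq> {}" "epi_converges (\<lambda>k. conjugate (max_affine (V k))) u"
proof -
  have not_MInf: "u x \<noteq> -\<infinity>" for x using u unfolding Conv_def by auto
  \<comment> \<open>Heights are values of \<open>u\<close> with opposite sign. Density in the graph,
    not only in the domain, makes the values converge along with the points.\<close>
  define G where "G = {(x, s::real). u x = ereal (- s)}"
  obtain T where T: "countable T" "T \<subseteq> G" "G \<subseteq> closure T"
    by (rule separable[of G])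
  obtain x0 where "u x0 \<noteq> \<infinity>" using u unfolding Conv_def by auto
  then have "(x0, - real_of_ereal (u x0)) \<in> G"
    using not_MInf[of x0] by (cases "u x0") (auto simp: G_def)
  then have "T \<noteq> {}" using T by auto
  define e where "e = from_nat_into T"
  have e_range: "range e = T"
    unfolding e_def using \<open>T \<noteq> {}\<close> T(1) by (rule range_from_nat_into)
  define V where "V k = e ` {..k}" for k
  have V: "finite (V k)" "V k \<noteq> {}" for k by (auto simp: V_def)
  have VG: "u (fst p) = ereal (- snd p)" if "p \<in> V k" for p k
    using that T(2) e_range by (force simp: V_def G_def)
  define U where "U k = conjugate (max_affine (V k))" for k
  have U_ge: "u y \<le> U k y" for k y
    unfolding U_def using VG by (intro conjugate_max_affine_ge[OF u V]) auto
  have U_eq: "U k (fst p) = ereal (- snd p)" if "p \<in> V k" for k p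
    using conjugate_max_affine_le[OF V(1) that] U_ge[of "fst p" k] VG[OF that]
    by (simp add: U_def)
  have "epi_converges U u"
    unfolding epi_converges_def
  proof (intro allI conjI impI)
    fix x and X :: "nat \<Rightarrow> real ^ 'n"
    assume "X \<longlonglongrightarrow> x"
    then have "u x \<le> liminf (\<lambda>k. u (X k))" by (rule Conv_liminf[OF u])
    also have "\<dots> \<le> liminf (\<lambda>k. U k (X k))"
      by (intro Liminf_mono always_eventually allI U_ge)
    finally show "u x \<le> liminf (\<lambda>k. U k (X k))" .
  next
    fix x
    show "\<exists>X. X \<longlonglongrightarrow> x \<and> (\<lambda>k. U k (X k)) \<longlonglongrightarrow> u x"
    proof (cases "u x = \<infinity>")
      case True
      then have "U k x = \<infinity>" for k using U_ge[of x k] by simp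
      then show ?thesis using True by (intro exI[of _ "\<lambda>_. x"]) simp
    next
      case False
      define q where "q = (x, - real_of_ereal (u x))"
      have ux: "u x = ereal (- snd q)" using False not_MInf[of x] by (cases "u x") (auto simp: q_def)
      then have "q \<in> closure T" using T(3) by (auto simp: G_def q_def)
      \<comment> \<open>Points of \<open>V k\<close> nearest to \<open>q\<close> converge to
        \<open>q\<close>, since the sets \<open>V k\<close> increase to the dense set
        \<open>T\<close>.\<close>
      have "\<exists>p\<in>V k. \<forall>p'\<in>V k. dist p q \<le> dist p' q" for k
        using ex_min_if_finite[of "(\<lambda>p. dist p q) ` V k"] V[of k] by (force simp: not_less)
      then obtain P where P: "\<And>k. P k \<in> V k" "\<And>k p. p \<in> V k \<Longrightarrow> dist (P k) q \<le> dist p q"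
        by metis
      have "P \<longlonglongrightarrow> q"
        unfolding lim_sequentially
      proof (intro allI impI)
        fix r :: real
        assume "0 < r"
        then obtain p where p: "p \<in> T" "dist p q < r"
          using \<open>q \<in> closure T\<close> by (auto simp: closure_approachable)
        then obtain i where "p = e i" using e_range by auto
        then have "dist (P k) q < r" if "i \<le> k" for k
          using P(2)[of p k] p(2) that by (auto simp: V_def)
        then show "\<exists>N. \<forall>k\<ge>N. dist (P k) q < r" by blast
      qed
      then have "(\<lambda>k. fst (P k)) \<longlonglongrightarrow> fst q" "(\<lambda>k. ereal (- snd (P k))) \<longlonglongrightarrow> ereal (- snd q)"
        by (intro tendsto_intros; assumption)+
      then have "(\<lambda>k. fst (P k)) \<longlonglongrightarrow> x" "(\<lambda>k. ereal (- snd (P k))) \<longlonglongrightarrow> u x"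
        unfolding ux by (simp_all add: q_def)
      then show ?thesis
        using U_eq[OF P(1)] by (intro exI[of _ "\<lambda>k. fst (P k)"]) simp
    qed
  qed
  then show ?thesis using that V unfolding U_def by blast
qed

section \<open>Compatibility of epi-multiplication with epi-convergence\<close>

lemma epi_converges_const:
  assumes "u \<in> Conv"
  shows "epi_converges (\<lambda>_. u) u"
  unfolding epi_converges_def using Conv_liminf[OF assms] by (auto intro: exI[of _ "\<lambda>_. _"])

text \<open>Both halves follow by rescaling sequences of points. The factors may vary with
  \<open>k\<close>, which also covers continuity in the dilation factor.\<close>

lemma epi_converges_epi_mult:
  assumes U: "epi_converges U u" and l: "l \<longlonglongrightarrow> r" "\<And>k. 0 < l k" "0 < r"
  shows "epi_converges (\<lambda>k. epi_mult (l k) (U k)) (epi_mult r u)"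
  unfolding epi_converges_def
proof (intro allI conjI impI)
  fix x and X :: "nat \<Rightarrow> real ^ 'a"
  assume "X \<longlonglongrightarrow> x"
  then have "(\<lambda>k. X k /\<^sub>R l k) \<longlonglongrightarrow> x /\<^sub>R r"
    using l by (intro tendsto_intros) auto
  then have "u (x /\<^sub>R r) \<le> liminf (\<lambda>k. U k (X k /\<^sub>R l k))"
    using U unfolding epi_converges_def by blast
  then have "ereal r * u (x /\<^sub>R r) \<le> ereal r * liminf (\<lambda>k. U k (X k /\<^sub>R l k))"
    using l(3) by (intro ereal_mult_left_mono) auto
  also have "\<dots> = liminf (\<lambda>k. ereal (l k) * U k (X k /\<^sub>R l k))"
    by (rule ereal_liminf_lim_mult[symmetric]) (use l in auto)
  finally show "epi_mult r u x \<le> liminf (\<lambda>k. epi_mult (l k) (U k) (X k))"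
    by (simp add: epi_mult_def)
next
  fix x
  obtain Y where Y: "Y \<longlonglongrightarrow> x /\<^sub>R r" "(\<lambda>k. U k (Y k)) \<longlonglongrightarrow> u (x /\<^sub>R r)"
    using U unfolding epi_converges_def by blast
  have "(\<lambda>k. l k *\<^sub>R Y k) \<longlonglongrightarrow> r *\<^sub>R (x /\<^sub>R r)"
    using l Y(1) by (intro tendsto_intros)
  then have "(\<lambda>k. l k *\<^sub>R Y k) \<longlonglongrightarrow> x"
    using l(3) by simp
  moreover have "(\<lambda>k. ereal (l k) * U k (Y k)) \<longlonglongrightarrow> ereal r * u (x /\<^sub>R r)"
    using l Y(2) by (intro tendsto_mult_ereal) auto
  ultimately show "\<exists>X. X \<longlonglongrightarrow> x \<and> (\<lambda>k. epi_mult (l k) (U k) (X k)) \<longlonglongrightarrow> epi_mult r u x"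
    using l(2) by (intro exI[of _ "\<lambda>k. l k *\<^sub>R Y k"]) (simp add: epi_mult_def less_imp_neq[symmetric])
qed

lemma epi_mult_epi_mult: "epi_mult a (epi_mult b u) = epi_mult (a * b) u"
  by (simp add: epi_mult_def mult.assoc[symmetric] mult.commute)

lemma epi_mult_1: "epi_mult 1 u = u"
  by (simp add: epi_mult_def flip: one_ereal_def)

lemma epi_mult_in_Conv_sc:
  assumes u: "u \<in> Conv_sc" and r: "0 < r"
  shows "epi_mult r u \<in> Conv_sc"
proof -
  have uC: "u \<in> Conv" using u by (rule Conv_scD)
  have "epi_mult r u x \<noteq> -\<infinity>" for x
    using uC r unfolding Conv_def epi_mult_def by auto
  moreover have "\<exists>x. epi_mult r u x \<noteq> \<infinity>"
  proof -
    obtain x where "u x \<noteq> \<infinity>" using uC unfolding Conv_def by auto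
    then have "epi_mult r u (r *\<^sub>R x) \<noteq> \<infinity>" using r by (simp add: epi_mult_def)
    then show ?thesis by blast
  qed
  moreover have "epi_mult r u ((1 - t) *\<^sub>R x + t *\<^sub>R y) \<le>
      ereal (1 - t) * epi_mult r u x + ereal t * epi_mult r u y"
    if t: "t \<in> {0..1}" for x y t
  proof -
    have "u (((1 - t) *\<^sub>R x + t *\<^sub>R y) /\<^sub>R r) = u ((1 - t) *\<^sub>R (x /\<^sub>R r) + t *\<^sub>R (y /\<^sub>R r))"
      by (simp add: algebra_simps)
    also have "\<dots> \<le> ereal (1 - t) * u (x /\<^sub>R r) + ereal t * u (y /\<^sub>R r)"
      using t by (intro Conv_convex[OF uC]) auto
    finally have "ereal r * u (((1 - t) *\<^sub>R x + t *\<^sub>R y) /\<^sub>R r) \<le>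
        ereal r * (ereal (1 - t) * u (x /\<^sub>R r) + ereal t * u (y /\<^sub>R r))"
      using r by (intro ereal_mult_left_mono) auto
    also have "\<dots> = ereal (1 - t) * (ereal r * u (x /\<^sub>R r)) + ereal t * (ereal r * u (y /\<^sub>R r))"
    proof -
      have "ereal s * u z \<noteq> -\<infinity>" if "0 \<le> s" for s z
        using that uC unfolding Conv_def by (cases "u z") auto
      then show ?thesis
        using t by (subst ereal_distrib_left) (auto simp: ac_simps)
    qed
    finally show ?thesis by (simp add: epi_mult_def)
  qed
  \<comment> \<open>Semicontinuity is the liminf half of epi-convergence for a constant
    sequence.\<close>
  moreover have "epi_mult r u x \<le> Liminf (at x) (epi_mult r u)" for x
    unfolding le_Liminf_iff
  proof (intro allI impI)
    fix t
    assume "t < epi_mult r u x"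
    show "eventually (\<lambda>y. t < epi_mult r u y) (at x)"
    proof (rule sequentially_imp_eventually_at, intro allI impI)
      fix X
      assume "(\<forall>n. X n \<noteq> x) \<and> X \<longlonglongrightarrow> x"
      then have "epi_mult r u x \<le> liminf (\<lambda>k. epi_mult r u (X k))"
        using epi_converges_epi_mult[OF epi_converges_const[OF uC], of "\<lambda>_. r" r] r
        unfolding epi_converges_def by auto
      then show "eventually (\<lambda>k. t < epi_mult r u (X k)) sequentially"
        using \<open>t < epi_mult r u x\<close> unfolding le_Liminf_iff by blast
    qed
  qed
  moreover have "((\<lambda>x. epi_mult r u x / ereal (norm x)) \<longlongrightarrow> \<infinity>) at_infinity"
  proof -
    have "filterlim (\<lambda>x::real ^ 'a. x /\<^sub>R r) at_infinity at_infinity"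
      unfolding filterlim_at_infinity_conv_norm_at_top norm_scaleR
      using r by (intro filterlim_tendsto_pos_mult_at_top[OF tendsto_const _ filterlim_norm_at_top]) auto
    then have "((\<lambda>x. u (x /\<^sub>R r) / ereal (norm (x /\<^sub>R r))) \<longlongrightarrow> \<infinity>) at_infinity"
      by (rule filterlim_compose[OF Conv_sc_tendsto[OF u]])
    moreover have "u (x /\<^sub>R r) / ereal (norm (x /\<^sub>R r)) = epi_mult r u x / ereal (norm x)" for x
      using r by (cases "x = 0"; cases "u (x /\<^sub>R r)") (auto simp: epi_mult_def field_simps zero_less_mult_iff mult_less_0_iff)
    ultimately show ?thesis by simp
  qed
  ultimately show ?thesis unfolding Conv_sc_def Conv_def by blast
qed

section \<open>The homogeneous decomposition\<close>

lemma epi_continuousD: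
  "\<lbrakk>epi_continuous F Z; u \<in> F; \<And>k. U k \<in> F; epi_converges U u\<rbrakk> \<Longrightarrow> (\<lambda>k. Z (U k)) \<longlonglongrightarrow> Z u"
  unfolding epi_continuous_def by blast

text \<open>The Lagrange interpolant of the values of \<open>Z\<close> at the integer dilates of
  \<open>u\<close>. Each coefficient is a fixed linear combination of these values and so inherits
  the properties of \<open>Z\<close>.\<close>

definition dilation_poly :: "((real ^ 'n \<Rightarrow> ereal) \<Rightarrow> real) \<Rightarrow> (real ^ 'n \<Rightarrow> ereal) \<Rightarrow> real poly" where
  "dilation_poly Z u = (\<Sum>j = 1..Suc CARD('n). smult (Z (epi_mult (real j) u)) (lagrange CARD('n) j))"

lemma degree_dilation_poly:
  fixes u :: "real ^ 'n \<Rightarrow> ereal"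
  shows "degree (dilation_poly Z u) \<le> CARD('n)"
  unfolding dilation_poly_def
  by (intro degree_sum_le) (auto intro: order.trans[OF degree_smult_le] degree_lagrange)

text \<open>Interpolation reproduces polynomials of degree at most \<open>CARD('n)\<close>, so the
  interpolant can be identified without computing coefficients.\<close>

lemma dilation_poly_unique:
  fixes u :: "real ^ 'n \<Rightarrow> ereal"
  assumes "degree p \<le> CARD('n)" "\<And>j. 0 < j \<Longrightarrow> poly p (real j) = Z (epi_mult (real j) u)"
  shows "dilation_poly Z u = p"
proof -
  have "(\<Sum>j = 1..Suc CARD('n). smult (Z (epi_mult (real j) u)) (lagrange CARD('n) j)) =
      (\<Sum>j = 1..Suc CARD('n). smult (poly p (real j)) (lagrange CARD('n) j))"
    using assms(2) by (intro sum.cong) auto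
  then show ?thesis
    using lagrange_interpolation[OF assms(1)] unfolding dilation_poly_def by simp
qed

lemma tendsto_poly_dilation_poly:
  fixes u :: "real ^ 'n \<Rightarrow> ereal"
  assumes "\<And>j. 0 < j \<Longrightarrow> (\<lambda>k. Z (epi_mult (real j) (U k))) \<longlonglongrightarrow> Z (epi_mult (real j) u)"
  shows "(\<lambda>k. poly (dilation_poly Z (U k)) r) \<longlonglongrightarrow> poly (dilation_poly Z u) r"
  unfolding dilation_poly_def poly_sum poly_smult
  by (intro tendsto_sum tendsto_mult tendsto_const assms) auto

text \<open>At the factors \<open>k / q\<close> the values of \<open>Z\<close> form a polynomial
  \<open>p\<close> in \<open>k\<close>. Substituting \<open>q\<close> times the variable gives a
  polynomial that is right at the integers \<open>(j * q) / q\<close>, hence is the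
  interpolant.\<close>

lemma poly_dilation_poly_conjugate_Rat:
  fixes V :: "((real ^ 'n) \<times> real) set"
  assumes val: "valuation Conv_sc Z" and inv: "epi_translation_invariant Conv_sc Z"
    and V: "finite V" "V \<noteq> {}" and "0 < m" "0 < q"
  defines "u \<equiv> conjugate (max_affine V)"
  shows "poly (dilation_poly Z u) (real m / real q) = Z (epi_mult (real m / real q) u)"
proof -
  define f where "f k = Z (conjugate (\<lambda>x. (1 / real q) * (real k * max_affine V x)))" for k
  \<comment> \<open>The index 0 is excluded: the conjugate of the zero function is not
    \<open>epi_mult 0 u\<close>.\<close>
  have f: "f k = Z (epi_mult (real k / real q) u)" if "0 < k" for k
    using conjugate_scale[of "real k / real q" "max_affine V"] that \<open>0 < q\<close>
    by (simp add: f_def u_def)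
  have "dual_valuation (\<lambda>w. Z (conjugate (\<lambda>x. (1 / real q) * w x)))"
    by (rule dual_valuation_scale[OF dual_valuation_conjugate[OF val inv]]) simp
  from binomial_sum_max_affine_DIM[OF this V]
  have "binomial_sum CARD('n) f" by (simp add: f_def[abs_def])
  then obtain p :: "real poly" where p: "degree p \<le> CARD('n)" "\<And>k. f k = poly p (real k)"
    by (rule binomial_sum_imp_poly) blast
  have at_ratio: "poly (pcompose p [:0, real q:]) (real k / real q) = Z (epi_mult (real k / real q) u)"
    if "0 < k" for k
    using f[OF that] p(2)[of k] \<open>0 < q\<close> by (simp add: poly_pcompose)
  have "dilation_poly Z u = pcompose p [:0, real q:]"
  proof (rule dilation_poly_unique)
    show "degree (pcompose p [:0, real q:]) \<le> CARD('n)"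
      using p(1) \<open>0 < q\<close> by (simp add: degree_pcompose)
    show "poly (pcompose p [:0, real q:]) (real j) = Z (epi_mult (real j) u)" if "0 < j" for j
      using at_ratio[of "j * q"] that \<open>0 < q\<close> by simp
  qed
  then show ?thesis using at_ratio[OF \<open>0 < m\<close>] by simp
qed

text \<open>Both sides are continuous in \<open>r\<close> and in \<open>u\<close>, so rational
  factors and conjugates of maxima of affine functions suffice.\<close>

lemma poly_dilation_poly:
  fixes u :: "real ^ 'n \<Rightarrow> ereal"
  assumes val: "valuation Conv_sc Z" and cont: "epi_continuous Conv_sc Z"
    and inv: "epi_translation_invariant Conv_sc Z" and u: "u \<in> Conv_sc" and r: "0 < r"
  shows "poly (dilation_poly Z u) r = Z (epi_mult r u)"
proof -
  have polytopal: "poly (dilation_poly Z u) r = Z (epi_mult r u)"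
    if V: "finite V" "V \<noteq> {}" and u_eq: "u = conjugate (max_affine V)" for V and u :: "real ^ 'n \<Rightarrow> ereal"
  proof -
    have u: "u \<in> Conv_sc" unfolding u_eq by (intro conjugate_in_Conv_sc dual_fun_max_affine V)
    \<comment> \<open>Rounding up gives rational factors that tend to \<open>r\<close> from above
      and have positive numerators.\<close>
    define m where "m k = nat \<lceil>r * real (Suc k)\<rceil>" for k
    define l where "l k = real (m k) / real (Suc k)" for k
    have m: "r * real (Suc k) \<le> real (m k)" "real (m k) \<le> r * real (Suc k) + 1" "0 < m k" for k
      using r unfolding m_def by (auto simp: less_ceiling_iff)
    have l: "r \<le> l k" "l k \<le> r + 1 / real (Suc k)" for k
    proof -
      have "l k * real (Suc k) = real (m k)" "(r + 1 / real (Suc k)) * real (Suc k) = r * real (Suc k) + 1"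
        by (simp_all add: l_def distrib_right)
      then have "r * real (Suc k) \<le> l k * real (Suc k)"
        "l k * real (Suc k) \<le> (r + 1 / real (Suc k)) * real (Suc k)"
        using m(1,2)[of k] by (simp_all only:)
      then show "r \<le> l k" "l k \<le> r + 1 / real (Suc k)"
        by (simp_all only: mult_le_cancel_right_pos of_nat_0_less_iff zero_less_Suc)
    qed
    have l_pos: "0 < l k" for k using l(1)[of k] r by linarith
    have "(\<lambda>k. r + 1 / real (Suc k)) \<longlonglongrightarrow> r + 0"
      by (intro tendsto_add tendsto_const LIMSEQ_Suc[OF lim_1_over_n])
    then have lim: "l \<longlonglongrightarrow> r"
      using l by (intro tendsto_sandwich[OF _ _ tendsto_const, of r l sequentially "\<lambda>k. r + 1 / real (Suc k)"]) auto
    have "(\<lambda>k. Z (epi_mult (l k) u)) \<longlonglongrightarrow> Z (epi_mult r u)"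
      using u r l_pos lim
      by (intro epi_continuousD[OF cont] epi_mult_in_Conv_sc epi_converges_epi_mult
          epi_converges_const Conv_scD) auto
    moreover have "(\<lambda>k. poly (dilation_poly Z u) (l k)) \<longlonglongrightarrow> poly (dilation_poly Z u) r"
      using lim by (intro tendsto_intros)
    moreover have "poly (dilation_poly Z u) (l k) = Z (epi_mult (l k) u)" for k
      unfolding u_eq l_def by (rule poly_dilation_poly_conjugate_Rat[OF val inv V m(3)]) simp
    ultimately show ?thesis by (simp add: LIMSEQ_unique)
  qed
  obtain V :: "nat \<Rightarrow> ((real ^ 'n) \<times> real) set"
    where V: "\<And>k. finite (V k)" "\<And>k. V k \<noteq> {}"
    and conv: "epi_converges (\<lambda>k. conjugate (max_affine (V k))) u"
    by (rule Conv_approximation[OF Conv_scD[OF u]]) (rule that)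
  have lim: "(\<lambda>k. Z (epi_mult s (conjugate (max_affine (V k))))) \<longlonglongrightarrow> Z (epi_mult s u)"
    if "0 < s" for s
    using that
    by (intro epi_continuousD[OF cont] epi_mult_in_Conv_sc u conjugate_in_Conv_sc
        dual_fun_max_affine V epi_converges_epi_mult[OF conv tendsto_const])
  have "(\<lambda>k. poly (dilation_poly Z (conjugate (max_affine (V k)))) r) \<longlonglongrightarrow> poly (dilation_poly Z u) r"
    by (intro tendsto_poly_dilation_poly lim) simp
  then show ?thesis
    using lim[OF r] polytopal[OF V refl] by (simp add: LIMSEQ_unique)
qed

section \<open>Finite combinations of dilates\<close>

context
  fixes Z :: "(real ^ 'n \<Rightarrow> ereal) \<Rightarrow> real" and J :: "nat set" and c :: "nat \<Rightarrow> real"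
  assumes J: "\<And>j. j \<in> J \<Longrightarrow> 0 < j"
begin

text \<open>Epi-multiplication by a positive factor commutes with pointwise maxima and
  minima.\<close>

lemma valuation_dilates:
  assumes val: "valuation Conv_sc Z"
  shows "valuation Conv_sc (\<lambda>u. \<Sum>j\<in>J. c j * Z (epi_mult (real j) u))"
  unfolding valuation_def
proof (intro ballI impI)
  fix u v :: "real ^ 'n \<Rightarrow> ereal"
  assume uv: "u \<in> Conv_sc" "v \<in> Conv_sc" "(\<lambda>x. max (u x) (v x)) \<in> Conv_sc" "(\<lambda>x. min (u x) (v x)) \<in> Conv_sc"
  have "Z (epi_mult (real j) (\<lambda>x. max (u x) (v x))) + Z (epi_mult (real j) (\<lambda>x. min (u x) (v x))) =
      Z (epi_mult (real j) u) + Z (epi_mult (real j) v)" if j: "j \<in> J" for j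
  proof -
    have pos: "0 < real j" using J[OF j] by simp
    have "ereal (real j) * max a b = max (ereal (real j) * a) (ereal (real j) * b)"
      "ereal (real j) * min a b = min (ereal (real j) * a) (ereal (real j) * b)" for a b
      using pos by (auto simp: max_def min_def ereal_mult_le_mult_iff)
    then have mm: "epi_mult (real j) (\<lambda>x. max (u x) (v x)) =
        (\<lambda>x. max (epi_mult (real j) u x) (epi_mult (real j) v x))"
      "epi_mult (real j) (\<lambda>x. min (u x) (v x)) =
        (\<lambda>x. min (epi_mult (real j) u x) (epi_mult (real j) v x))"
      by (simp_all add: epi_mult_def)
    show ?thesis
      using valuationD[OF val epi_mult_in_Conv_sc[OF uv(1) pos] epi_mult_in_Conv_sc[OF uv(2) pos]]
        epi_mult_in_Conv_sc[OF uv(3) pos] epi_mult_in_Conv_sc[OF uv(4) pos]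
      unfolding mm by blast
  qed
  then show "(\<Sum>j\<in>J. c j * Z (epi_mult (real j) (\<lambda>x. max (u x) (v x)))) +
      (\<Sum>j\<in>J. c j * Z (epi_mult (real j) (\<lambda>x. min (u x) (v x)))) =
      (\<Sum>j\<in>J. c j * Z (epi_mult (real j) u)) + (\<Sum>j\<in>J. c j * Z (epi_mult (real j) v))"
    by (simp flip: sum.distrib distrib_left)
qed

lemma epi_continuous_dilates:
  assumes cont: "epi_continuous Conv_sc Z"
  shows "epi_continuous Conv_sc (\<lambda>u. \<Sum>j\<in>J. c j * Z (epi_mult (real j) u))"
  unfolding epi_continuous_def
proof (intro allI ballI impI)
  fix U and u :: "real ^ 'n \<Rightarrow> ereal"
  assume "u \<in> Conv_sc" "\<forall>k. U k \<in> Conv_sc" "epi_converges U u"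
  then have "(\<lambda>k. Z (epi_mult (real j) (U k))) \<longlonglongrightarrow> Z (epi_mult (real j) u)" if "j \<in> J" for j
    using J[OF that]
    by (intro epi_continuousD[OF cont] epi_mult_in_Conv_sc epi_converges_epi_mult tendsto_const) auto
  then show "(\<lambda>k. \<Sum>j\<in>J. c j * Z (epi_mult (real j) (U k))) \<longlonglongrightarrow>
      (\<Sum>j\<in>J. c j * Z (epi_mult (real j) u))"
    by (intro tendsto_sum tendsto_mult tendsto_const)
qed

text \<open>Dilation by \<open>j\<close> turns a translation by \<open>a\<close> into one by
  \<open>real j *\<^sub>R a\<close>, and a constant \<open>d\<close> into
  \<open>real j * d\<close>.\<close>

lemma epi_translation_invariant_dilates:
  assumes inv: "epi_translation_invariant Conv_sc Z"
  shows "epi_translation_invariant Conv_sc (\<lambda>u. \<Sum>j\<in>J. c j * Z (epi_mult (real j) u))"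
  unfolding epi_translation_invariant_def translation_invariant_def vertically_translation_invariant_def
proof (intro conjI ballI allI)
  fix u :: "real ^ 'n \<Rightarrow> ereal" and a and d :: real
  assume u: "u \<in> Conv_sc"
  show "(\<Sum>j\<in>J. c j * Z (epi_mult (real j) (\<lambda>x. u (x - a)))) = (\<Sum>j\<in>J. c j * Z (epi_mult (real j) u))"
  proof (rule sum.cong[OF refl])
    fix j assume j: "j \<in> J"
    have "epi_mult (real j) (\<lambda>x. u (x - a)) = (\<lambda>x. epi_mult (real j) u (x - real j *\<^sub>R a))"
      using J[OF j] by (simp add: epi_mult_def scaleR_diff_right)
    then show "c j * Z (epi_mult (real j) (\<lambda>x. u (x - a))) = c j * Z (epi_mult (real j) u)"
      using inv epi_mult_in_Conv_sc[OF u, of "real j"] J[OF j]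
      unfolding epi_translation_invariant_def translation_invariant_def by simp
  qed
  show "(\<Sum>j\<in>J. c j * Z (epi_mult (real j) (\<lambda>x. u x + ereal d))) = (\<Sum>j\<in>J. c j * Z (epi_mult (real j) u))"
  proof (rule sum.cong[OF refl])
    fix j assume j: "j \<in> J"
    have "epi_mult (real j) (\<lambda>x. u x + ereal d) = (\<lambda>x. epi_mult (real j) u x + ereal (real j * d))"
      by (simp add: epi_mult_def ereal_distrib_left)
    then show "c j * Z (epi_mult (real j) (\<lambda>x. u x + ereal d)) = c j * Z (epi_mult (real j) u)"
      using inv epi_mult_in_Conv_sc[OF u, of "real j"] J[OF j]
      unfolding epi_translation_invariant_def vertically_translation_invariant_def by simp
  qed
qed

end

theorem theorem1:
  fixes Z :: "(real ^ 'n \<Rightarrow> ereal) \<Rightarrow> real"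
  assumes "valuation Conv_sc Z"
    and "epi_continuous Conv_sc Z"
    and "epi_translation_invariant Conv_sc Z"
  shows "\<exists>Zs :: nat \<Rightarrow> (real ^ 'n \<Rightarrow> ereal) \<Rightarrow> real.
           (\<forall>i\<in>{0..CARD('n)}.
              valuation Conv_sc (Zs i) \<and>
              epi_continuous Conv_sc (Zs i) \<and>
              epi_translation_invariant Conv_sc (Zs i) \<and>
              epi_homogeneous Conv_sc (real i) (Zs i)) \<and>
           (\<forall>u\<in>Conv_sc. Z u = (\<Sum>i = 0..CARD('n). Zs i u))"
proof (intro exI[of _ "\<lambda>i u. coeff (dilation_poly Z u) i"] conjI ballI)
  fix i
  \<comment> \<open>The component of degree \<open>i\<close> is a combination of dilates, weighted
    by the coefficients of the Lagrange basis polynomials.\<close>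
  have eq: "(\<lambda>u. coeff (dilation_poly Z u) i) =
      (\<lambda>u. \<Sum>j\<in>{1..Suc CARD('n)}. coeff (lagrange CARD('n) j) i * Z (epi_mult (real j) u))"
    by (simp only: dilation_poly_def coeff_sum coeff_smult mult.commute)
  show "valuation Conv_sc (\<lambda>u. coeff (dilation_poly Z u) i)"
    unfolding eq by (rule valuation_dilates[OF _ assms(1)]) simp
  show "epi_continuous Conv_sc (\<lambda>u. coeff (dilation_poly Z u) i)"
    unfolding eq by (rule epi_continuous_dilates[OF _ assms(2)]) simp
  show "epi_translation_invariant Conv_sc (\<lambda>u. coeff (dilation_poly Z u) i)"
    unfolding eq by (rule epi_translation_invariant_dilates[OF _ assms(3)]) simp
  show "epi_homogeneous Conv_sc (real i) (\<lambda>u. coeff (dilation_poly Z u) i)"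
    unfolding epi_homogeneous_def
  proof (intro ballI allI impI)
    fix u :: "real ^ 'n \<Rightarrow> ereal" and l :: real
    assume u: "u \<in> Conv_sc" and l: "0 < l"
    \<comment> \<open>Both polynomials take the value \<open>Z (epi_mult (real j * l) u)\<close> at
      each positive integer \<open>j\<close>; comparing coefficients gives the factor
      \<open>l ^ i\<close>.\<close>
    have "dilation_poly Z (epi_mult l u) = pcompose (dilation_poly Z u) [:0, l:]"
    proof (rule dilation_poly_unique)
      show "degree (pcompose (dilation_poly Z u) [:0, l:]) \<le> CARD('n)"
        using degree_dilation_poly[of Z u] l by (simp add: degree_pcompose)
      show "poly (pcompose (dilation_poly Z u) [:0, l:]) (real j) = Z (epi_mult (real j) (epi_mult l u))"
        if "0 < j" for j
        using poly_dilation_poly[OF assms u, of "real j * l"] that l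
        by (simp add: poly_pcompose epi_mult_epi_mult)
    qed
    then show "coeff (dilation_poly Z (epi_mult l u)) i = l powr real i * coeff (dilation_poly Z u) i"
      using l by (simp add: coeff_pcompose_linear powr_realpow)
  qed
next
  fix u :: "real ^ 'n \<Rightarrow> ereal"
  assume u: "u \<in> Conv_sc"
  \<comment> \<open>The value of a polynomial at 1 is the sum of its coefficients.\<close>
  have "Z u = poly (dilation_poly Z u) 1"
    using poly_dilation_poly[OF assms u, of 1] by (simp add: epi_mult_1)
  also have "\<dots> = (\<Sum>i\<le>CARD('n). coeff (dilation_poly Z u) i)"
    by (subst (1) poly_as_sum_of_monoms'[OF degree_dilation_poly[of Z u], symmetric])
      (simp add: poly_sum poly_monom)
  finally show "Z u = (\<Sum>i = 0..CARD('n). coeff (dilation_poly Z u) i)"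
    by (simp add: atLeast0AtMost)
qed

end
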